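(* Let $n\geq 2$, let $\{\lambda_{i,jk} : 1\leq i\leq k,\ 1\leq j<k\leq n\}\subseteq\mathbb{T}$ be given, and let $\sigma$ be the two-cocycle of $G(n)$ $$\sigma(r,s)=\prod_{1\leq i<j<k\leq n}\lambda_{i,jk}^{s_{jk}r_i+s_kr_{ij}}\,\lambda_{j,ik}^{s_{ik}r_j+s_k(r_ir_j-r_{ij})}\cdot\prod_{1\leq j<k\leq n}\lambda_{j,jk}^{s_{jk}r_j+\frac{1}{2}s_kr_j(r_j-1)}\,\lambda_{k,jk}^{r_k(s_{jk}+r_js_k)+\frac{1}{2}r_js_k(s_k-1)}.$$ Set $\lambda_{k,ij}=\overline{\lambda_{i,jk}}\,\lambda_{j,ik}$ whenever $1\leq i<j<k\leq n$. Then the twisted group $C^*$-algebra $C^*(G(n),\sigma)$ is the universal $C^*$-algebra generated by unitaries $\{U_i\}_{1\leq i\leq n}$ and $\{V_{jk}\}_{1\leq j<k\leq n}$ satisfying the relations $$[V_{jk},V_{lm}]=I,\qquad [U_i,V_{jk}]=\lambda_{i,jk}I,\qquad [U_j,U_k]=V_{jk}$$ for $1\leq i\leq n$, $1\leq j<k\leq n$, and $1\leq l<m\leq n$.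
   Context: $[x,y]=xyx^{-1}y^{-1}$. $G(n)$ is the free nilpotent group of class $2$ and rank $n$, realized as the set of integer tuples $r=(r_1,\dotsc,r_n,(r_{jk})_{1\leq j<k\leq n})$ with multiplication $(rs)_i=r_i+s_i$ and $(rs)_{jk}=r_{jk}+s_{jk}+r_js_k$. A two-cocycle of a discrete group $G$ is a function $\sigma\colon G\times G\to\mathbb{T}$ with $\sigma(r,s)\sigma(rs,t)=\sigma(r,st)\sigma(s,t)$ and $\sigma(r,e)=\sigma(e,r)=1$. A $\sigma$-projective unitary representation of $G$ in a unital $C^*$-algebra $B$ is a map $U$ from $G$ to the unitaries of $B$ with $U(r)U(s)=\sigma(r,s)U(rs)$. The full twisted group $C^*$-algebra $C^*(G,\sigma)$ is the $C^*$-algebra generated by a $\sigma$-projective unitary representation $i_\sigma\colon G\to C^*(G,\sigma)$ through which every $\sigma$-projective unitary representation of $G$ factors uniquely. *)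

theory Defs
  imports Complex_Main "HOL-Algebra.Module"
begin

section \<open>Unital C*-algebras\<close>

definition complex_field :: "complex ring" where
  "complex_field = \<lparr>carrier = UNIV, mult = (*), one = 1, zero = 0, add = (+)\<rparr>"

record 'a cstar = "(complex, 'a) module" +
  adj :: "'a \<Rightarrow> 'a"
  cnorm :: "'a \<Rightarrow> real"

text \<open>The zero algebra is admitted, so the norm of the unit is not required to be \<open>1\<close>
  (for a nonzero algebra this follows from the C*-identity).\<close>

locale unital_cstar_algebra = A?: ring A + module complex_field A
  for A :: "('a, 'm) cstar_scheme" (structure) +
  assumes smult_mult_left: "\<lbrakk>x \<in> carrier A; y \<in> carrier A\<rbrakk>
      \<Longrightarrow> (c \<odot> x) \<otimes> y = c \<odot> (x \<otimes> y)"
    and smult_mult_right: "\<lbrakk>x \<in> carrier A; y \<in> carrier A\<rbrakk>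
      \<Longrightarrow> x \<otimes> (c \<odot> y) = c \<odot> (x \<otimes> y)"
    and adj_closed: "x \<in> carrier A \<Longrightarrow> adj A x \<in> carrier A"
    and adj_adj: "x \<in> carrier A \<Longrightarrow> adj A (adj A x) = x"
    and adj_add: "\<lbrakk>x \<in> carrier A; y \<in> carrier A\<rbrakk>
      \<Longrightarrow> adj A (x \<oplus> y) = adj A x \<oplus> adj A y"
    and adj_smult: "x \<in> carrier A \<Longrightarrow> adj A (c \<odot> x) = cnj c \<odot> adj A x"
    and adj_mult: "\<lbrakk>x \<in> carrier A; y \<in> carrier A\<rbrakk>
      \<Longrightarrow> adj A (x \<otimes> y) = adj A y \<otimes> adj A x"
    and cnorm_nonneg: "x \<in> carrier A \<Longrightarrow> 0 \<le> cnorm A x"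
    and cnorm_eq_0: "x \<in> carrier A \<Longrightarrow> cnorm A x = 0 \<longleftrightarrow> x = \<zero>"
    and cnorm_triangle: "\<lbrakk>x \<in> carrier A; y \<in> carrier A\<rbrakk>
      \<Longrightarrow> cnorm A (x \<oplus> y) \<le> cnorm A x + cnorm A y"
    and cnorm_smult: "x \<in> carrier A \<Longrightarrow> cnorm A (c \<odot> x) = cmod c * cnorm A x"
    and cnorm_mult: "\<lbrakk>x \<in> carrier A; y \<in> carrier A\<rbrakk>
      \<Longrightarrow> cnorm A (x \<otimes> y) \<le> cnorm A x * cnorm A y"
    and cstar_identity: "x \<in> carrier A \<Longrightarrow> cnorm A (adj A x \<otimes> x) = (cnorm A x)\<^sup>2"
    and complete: "\<lbrakk>range X \<subseteq> carrier A;
        \<forall>e>0. \<exists>N. \<forall>p\<ge>N. \<forall>q\<ge>N. cnorm A (X p \<ominus> X q) < e\<rbrakk>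
      \<Longrightarrow> \<exists>x\<in>carrier A. (\<lambda>p. cnorm A (X p \<ominus> x)) \<longlonglongrightarrow> 0"

definition unitary :: "('a, 'm) cstar_scheme \<Rightarrow> 'a \<Rightarrow> bool" where
  "unitary A u \<longleftrightarrow> u \<in> carrier A \<and> adj A u \<otimes>\<^bsub>A\<^esub> u = \<one>\<^bsub>A\<^esub> \<and> u \<otimes>\<^bsub>A\<^esub> adj A u = \<one>\<^bsub>A\<^esub>"

definition commutator :: "('a, 'm) monoid_scheme \<Rightarrow> 'a \<Rightarrow> 'a \<Rightarrow> 'a" where
  "commutator A x y = x \<otimes>\<^bsub>A\<^esub> y \<otimes>\<^bsub>A\<^esub> inv\<^bsub>A\<^esub> x \<otimes>\<^bsub>A\<^esub> inv\<^bsub>A\<^esub> y"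

text \<open>Unital *-homomorphisms; they are functions on the carrier only, made unique as HOL
  functions by extensionality. Preservation of the unit is part of \<^const>\<open>ring_hom\<close>.\<close>

definition star_hom :: "('a, 'm) cstar_scheme \<Rightarrow> ('b, 'k) cstar_scheme \<Rightarrow> ('a \<Rightarrow> 'b) set" where
  "star_hom A B = {\<phi> \<in> ring_hom A B \<inter> extensional (carrier A).
     (\<forall>c. \<forall>x\<in>carrier A. \<phi> (c \<odot>\<^bsub>A\<^esub> x) = c \<odot>\<^bsub>B\<^esub> \<phi> x) \<and>
     (\<forall>x\<in>carrier A. \<phi> (adj A x) = adj B (\<phi> x))}"

definition closed_star_subalgebra :: "('a, 'm) cstar_scheme \<Rightarrow> 'a set \<Rightarrow> bool" where
  "closed_star_subalgebra A S \<longleftrightarrow>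
     S \<subseteq> carrier A \<and> \<zero>\<^bsub>A\<^esub> \<in> S \<and>
     (\<forall>x\<in>S. \<forall>y\<in>S. x \<oplus>\<^bsub>A\<^esub> y \<in> S \<and> x \<otimes>\<^bsub>A\<^esub> y \<in> S) \<and>
     (\<forall>c. \<forall>x\<in>S. c \<odot>\<^bsub>A\<^esub> x \<in> S) \<and>
     (\<forall>x\<in>S. adj A x \<in> S) \<and>
     (\<forall>X. \<forall>x\<in>carrier A. range X \<subseteq> S \<longrightarrow> (\<lambda>p. cnorm A (X p \<ominus>\<^bsub>A\<^esub> x)) \<longlonglongrightarrow> 0 \<longrightarrow> x \<in> S)"

definition cstar_generated_by :: "('a, 'm) cstar_scheme \<Rightarrow> 'a set \<Rightarrow> bool" where
  "cstar_generated_by A S \<longleftrightarrow>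
     S \<subseteq> carrier A \<and> \<Inter>{T. closed_star_subalgebra A T \<and> S \<subseteq> T} = carrier A"


section \<open>Twisted group C*-algebras\<close>

definition two_cocycle :: "('g, 'm) monoid_scheme \<Rightarrow> ('g \<Rightarrow> 'g \<Rightarrow> complex) \<Rightarrow> bool" where
  "two_cocycle G \<sigma> \<longleftrightarrow>
     (\<forall>r\<in>carrier G. \<forall>s\<in>carrier G. cmod (\<sigma> r s) = 1) \<and>
     (\<forall>r\<in>carrier G. \<forall>s\<in>carrier G. \<forall>t\<in>carrier G.
        \<sigma> r s * \<sigma> (r \<otimes>\<^bsub>G\<^esub> s) t = \<sigma> r (s \<otimes>\<^bsub>G\<^esub> t) * \<sigma> s t) \<and>
     (\<forall>r\<in>carrier G. \<sigma> r \<one>\<^bsub>G\<^esub> = 1 \<and> \<sigma> \<one>\<^bsub>G\<^esub> r = 1)"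

definition projective_unitary_rep ::
  "('g, 'm) monoid_scheme \<Rightarrow> ('g \<Rightarrow> 'g \<Rightarrow> complex) \<Rightarrow> ('a, 'k) cstar_scheme \<Rightarrow> ('g \<Rightarrow> 'a) \<Rightarrow> bool" where
  "projective_unitary_rep G \<sigma> B U \<longleftrightarrow>
     (\<forall>r\<in>carrier G. unitary B (U r)) \<and>
     (\<forall>r\<in>carrier G. \<forall>s\<in>carrier G. U r \<otimes>\<^bsub>B\<^esub> U s = \<sigma> r s \<odot>\<^bsub>B\<^esub> U (r \<otimes>\<^bsub>G\<^esub> s))"

text \<open>
  Both universal objects below are given by their universal properties. HOL cannot quantify over
  types inside a formula, so the test algebras \<open>B\<close> range over all unital C*-algebras whose carrier
  is a subset of a type \<open>'b\<close>, which is an explicit parameter. A theorem that is polymorphic in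
  \<open>'b\<close> therefore speaks about test algebras of arbitrary size.
\<close>

definition is_twisted_group_cstar ::
  "'b itself \<Rightarrow> ('g, 'm) monoid_scheme \<Rightarrow> ('g \<Rightarrow> 'g \<Rightarrow> complex) \<Rightarrow> 'a cstar \<Rightarrow> ('g \<Rightarrow> 'a) \<Rightarrow> bool" where
  "is_twisted_group_cstar (_ :: 'b itself) G \<sigma> A \<iota> \<longleftrightarrow>
     unital_cstar_algebra A \<and>
     projective_unitary_rep G \<sigma> A \<iota> \<and>
     cstar_generated_by A (\<iota> ` carrier G) \<and>
     (\<forall>(B :: 'b cstar) U. unital_cstar_algebra B \<and> projective_unitary_rep G \<sigma> B U \<longrightarrow>
        (\<exists>!\<phi>. \<phi> \<in> star_hom A B \<and> (\<forall>r\<in>carrier G. \<phi> (\<iota> r) = U r)))"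


section \<open>The free nilpotent group of class 2 and rank n\<close>

definition index_pairs :: "nat \<Rightarrow> (nat \<times> nat) set" where
  "index_pairs n = {(j, k). 1 \<le> j \<and> j < k \<and> k \<le> n}"

definition index_triples :: "nat \<Rightarrow> (nat \<times> nat \<times> nat) set" where
  "index_triples n = {(i, j, k). 1 \<le> i \<and> i < j \<and> j < k \<and> k \<le> n}"

text \<open>A tuple \<open>r\<close> is the pair of \<open>(r\<^sub>i)\<close> and \<open>(r\<^sub>j\<^sub>k)\<close>, extended by \<open>0\<close> outside the index range.\<close>

type_synonym tuple = "(nat \<Rightarrow> int) \<times> (nat \<Rightarrow> nat \<Rightarrow> int)"

definition free_nil2 :: "nat \<Rightarrow> tuple monoid" where
  "free_nil2 n =
     \<lparr>carrier = {r. (\<forall>i. i \<notin> {1..n} \<longrightarrow> fst r i = 0) \<and>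
                    (\<forall>j k. (j, k) \<notin> index_pairs n \<longrightarrow> snd r j k = 0)},
      mult = (\<lambda>r s. (\<lambda>i. fst r i + fst s i,
                     \<lambda>j k. if (j, k) \<in> index_pairs n
                           then snd r j k + snd s j k + fst r j * fst s k else 0)),
      one = (\<lambda>_. 0, \<lambda>_ _. 0)\<rparr>"

definition gen_u :: "nat \<Rightarrow> tuple" where
  "gen_u i = (\<lambda>l. if l = i then 1 else 0, \<lambda>_ _. 0)"

definition gen_v :: "nat \<Rightarrow> nat \<Rightarrow> tuple" where
  "gen_v j k = (\<lambda>_. 0, \<lambda>l m. if l = j \<and> m = k then 1 else 0)"

text \<open>\<open>lam i j k\<close> stands for \<open>\<lambda>\<^bsub>i,jk\<^esub>\<close>. The divisions by \<open>2\<close> are exact.\<close>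

definition sigma :: "nat \<Rightarrow> (nat \<Rightarrow> nat \<Rightarrow> nat \<Rightarrow> complex) \<Rightarrow> tuple \<Rightarrow> tuple \<Rightarrow> complex" where
  "sigma n lam r s = (case r of (a, c) \<Rightarrow> case s of (b, d) \<Rightarrow>
     (\<Prod>(i, j, k)\<in>index_triples n.
        lam i j k powi (d j k * a i + b k * c i j) *
        lam j i k powi (d i k * a j + b k * (a i * a j - c i j))) *
     (\<Prod>(j, k)\<in>index_pairs n.
        lam j j k powi (d j k * a j + b k * a j * (a j - 1) div 2) *
        lam k j k powi (a k * (d j k + a j * b k) + a j * b k * (b k - 1) div 2)))"

text \<open>The given \<open>\<lambda>\<^bsub>i,jk\<^esub>\<close> have \<open>i \<le> k\<close>; for \<open>i > k\<close> the value is
  \<open>\<lambda>\<^bsub>i,jk\<^esub> = cnj \<lambda>\<^bsub>j,ki\<^esub> * \<lambda>\<^bsub>k,ji\<^esub>\<close>.\<close>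

definition lam_ext :: "(nat \<Rightarrow> nat \<Rightarrow> nat \<Rightarrow> complex) \<Rightarrow> nat \<Rightarrow> nat \<Rightarrow> nat \<Rightarrow> complex" where
  "lam_ext lam i j k = (if i \<le> k then lam i j k else cnj (lam j k i) * lam k j i)"


section \<open>The universal C*-algebra of the relations\<close>

definition satisfies_relations ::
  "nat \<Rightarrow> (nat \<Rightarrow> nat \<Rightarrow> nat \<Rightarrow> complex) \<Rightarrow> ('a, 'm) cstar_scheme \<Rightarrow>
   (nat \<Rightarrow> 'a) \<Rightarrow> (nat \<Rightarrow> nat \<Rightarrow> 'a) \<Rightarrow> bool" where
  "satisfies_relations n lam B U V \<longleftrightarrow>
     (\<forall>i\<in>{1..n}. unitary B (U i)) \<and>
     (\<forall>(j, k)\<in>index_pairs n. unitary B (V j k)) \<and>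
     (\<forall>(j, k)\<in>index_pairs n. \<forall>(l, m)\<in>index_pairs n.
        commutator B (V j k) (V l m) = \<one>\<^bsub>B\<^esub>) \<and>
     (\<forall>i\<in>{1..n}. \<forall>(j, k)\<in>index_pairs n.
        commutator B (U i) (V j k) = lam i j k \<odot>\<^bsub>B\<^esub> \<one>\<^bsub>B\<^esub>) \<and>
     (\<forall>(j, k)\<in>index_pairs n. commutator B (U j) (U k) = V j k)"

definition is_universal_cstar ::
  "'b itself \<Rightarrow> nat \<Rightarrow> (nat \<Rightarrow> nat \<Rightarrow> nat \<Rightarrow> complex) \<Rightarrow> 'a cstar \<Rightarrow>
   (nat \<Rightarrow> 'a) \<Rightarrow> (nat \<Rightarrow> nat \<Rightarrow> 'a) \<Rightarrow> bool" where
  "is_universal_cstar (_ :: 'b itself) n lam A U V \<longleftrightarrow>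
     unital_cstar_algebra A \<and>
     satisfies_relations n lam A U V \<and>
     cstar_generated_by A (U ` {1..n} \<union> (\<lambda>(j, k). V j k) ` index_pairs n) \<and>
     (\<forall>(B :: 'b cstar) U' V'. unital_cstar_algebra B \<and> satisfies_relations n lam B U' V' \<longrightarrow>
        (\<exists>!\<phi>. \<phi> \<in> star_hom A B \<and> (\<forall>i\<in>{1..n}. \<phi> (U i) = U' i) \<and>
               (\<forall>(j, k)\<in>index_pairs n. \<phi> (V j k) = V' j k)))"


section \<open>The data are well defined\<close>

lemma index_pairsD: "(j, k) \<in> index_pairs n \<Longrightarrow> j \<in> {1..n} \<and> k \<in> {1..n}"
  by (auto simp: index_pairs_def)

lemma group_free_nil2: "group (free_nil2 n)"
proof (rule groupI)
  fix x assume x: "x \<in> carrier (free_nil2 n)"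
  let ?y = "(\<lambda>i. - fst x i, \<lambda>j k. if (j, k) \<in> index_pairs n
              then fst x j * fst x k - snd x j k else 0)"
  have "?y \<in> carrier (free_nil2 n)" using x by (simp add: free_nil2_def)
  moreover have "?y \<otimes>\<^bsub>free_nil2 n\<^esub> x = \<one>\<^bsub>free_nil2 n\<^esub>"
    using x by (auto simp: free_nil2_def fun_eq_iff)
  ultimately show "\<exists>y\<in>carrier (free_nil2 n). y \<otimes>\<^bsub>free_nil2 n\<^esub> x = \<one>\<^bsub>free_nil2 n\<^esub>" by blast
next
  fix x assume "x \<in> carrier (free_nil2 n)"
  then show "\<one>\<^bsub>free_nil2 n\<^esub> \<otimes>\<^bsub>free_nil2 n\<^esub> x = x"
    by (cases x) (auto simp: free_nil2_def fun_eq_iff)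
qed (auto simp: free_nil2_def fun_eq_iff algebra_simps)

lemma double_half: "2 * (b * x * (x - 1) div 2) = b * x * (x - 1 :: int)"
  by simp

lemma exponent_identity_j:
  fixes a :: int
  shows "(d * a + b * a * (a - 1) div 2) + (h * (a + a') + f * (a + a') * (a + a' - 1) div 2)
       = ((d + h + a' * f) * a + (b + f) * a * (a - 1) div 2) + (h * a' + f * a' * (a' - 1) div 2)"
proof -
  define w x y z where "w = b * a * (a - 1) div 2" and "x = f * (a + a') * (a + a' - 1) div 2"
    and "y = (b + f) * a * (a - 1) div 2" and "z = f * a' * (a' - 1) div 2"
  have "2 * w = b * a * (a - 1)" "2 * x = f * (a + a') * (a + a' - 1)"
    "2 * y = (b + f) * a * (a - 1)" "2 * z = f * a' * (a' - 1)"
    unfolding w_def x_def y_def z_def by (rule double_half)+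
  then have "2 * w + 2 * x + 2 * (h * (a + a')) = 2 * y + 2 * z + 2 * (h * (a + a')) + 2 * (a' * f * a)"
    by (simp add: algebra_simps)
  then show ?thesis
    unfolding w_def[symmetric] x_def[symmetric] y_def[symmetric] z_def[symmetric]
    by (simp add: algebra_simps)
qed

lemma exponent_identity_k:
  fixes a :: int
  shows "(a * (d + p * b) + p * b * (b - 1) div 2)
         + ((a + b) * (h + (p + q) * f) + (p + q) * f * (f - 1) div 2)
       = (a * (d + h + q * f + p * (b + f)) + p * (b + f) * (b + f - 1) div 2)
         + (b * (h + q * f) + q * f * (f - 1) div 2)"
proof -
  define w x y z where "w = p * b * (b - 1) div 2" and "x = (p + q) * f * (f - 1) div 2"
    and "y = p * (b + f) * (b + f - 1) div 2" and "z = q * f * (f - 1) div 2"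
  have "2 * w = p * b * (b - 1)" "2 * x = (p + q) * f * (f - 1)"
    "2 * y = p * (b + f) * (b + f - 1)" "2 * z = q * f * (f - 1)"
    unfolding w_def x_def y_def z_def by (rule double_half)+
  then have "2 * w + 2 * x + 2 * (b * p * f) = 2 * y + 2 * z"
    by (simp add: algebra_simps)
  then show ?thesis
    unfolding w_def[symmetric] x_def[symmetric] y_def[symmetric] z_def[symmetric]
    by (simp add: algebra_simps)
qed

lemma powi_split:
  assumes "cmod x = 1" "p + q = p' + q'"
  shows "x powi p * x powi q = x powi p' * x powi q'"
proof -
  have "x \<noteq> 0" using assms(1) by auto
  then show ?thesis using assms(2) by (metis power_int_add)
qed

lemma quad_cong:
  assumes "x1 * x2 = x3 * x4" "y1 * y2 = y3 * y4"
  shows "x1 * y1 * (x2 * y2) = x3 * y3 * (x4 * y4 :: complex)"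
proof -
  have "x1 * y1 * (x2 * y2) = (x1 * x2) * (y1 * y2)" by (simp only: mult_ac)
  also have "\<dots> = x3 * y3 * (x4 * y4)" unfolding assms by (simp only: mult_ac)
  finally show ?thesis .
qed

lemma one_mult_one: "\<lbrakk>x = 1; y = 1\<rbrakk> \<Longrightarrow> x * y = (1 :: real)"
  by simp

lemma two_cocycle_sigma:
  assumes lam: "\<And>i j k. \<lbrakk>1 \<le> i; i \<le> k; 1 \<le> j; j < k; k \<le> n\<rbrakk> \<Longrightarrow> cmod (lam i j k) = 1"
  shows "two_cocycle (free_nil2 n) (sigma n lam)"
  unfolding two_cocycle_def
proof (intro conjI ballI)
  let ?G = "free_nil2 n"
  fix r assume "r \<in> carrier ?G"
  show "sigma n lam r \<one>\<^bsub>?G\<^esub> = 1" "sigma n lam \<one>\<^bsub>?G\<^esub> r = 1"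
    by (auto simp: sigma_def free_nil2_def split: prod.splits)
next
  let ?G = "free_nil2 n"
  fix r s assume "r \<in> carrier ?G" "s \<in> carrier ?G"
  show "cmod (sigma n lam r s) = 1"
    unfolding sigma_def case_prod_beta norm_mult prod_norm[symmetric] norm_power_int
    by (rule one_mult_one; rule prod.neutral)
      (auto simp: lam index_pairs_def index_triples_def)
next
  let ?G = "free_nil2 n"
  fix r s t assume *: "r \<in> carrier ?G" "s \<in> carrier ?G" "t \<in> carrier ?G"
  obtain a c where r: "r = (a, c)" by (cases r)
  obtain b d where s: "s = (b, d)" by (cases s)
  obtain e f where t: "t = (e, f)" by (cases t)
  have T: "lam i j k powi (d j k * a i + b k * c i j) *
           lam j i k powi (d i k * a j + b k * (a i * a j - c i j)) *
          (lam i j k powi (f j k * (a i + b i) + e k * (c i j + d i j + a i * b j)) *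
           lam j i k powi (f i k * (a j + b j) + e k * ((a i + b i) * (a j + b j) - (c i j + d i j + a i * b j))))
        = lam i j k powi ((d j k + f j k + b j * e k) * a i + (b k + e k) * c i j) *
           lam j i k powi ((d i k + f i k + b i * e k) * a j + (b k + e k) * (a i * a j - c i j)) *
          (lam i j k powi (f j k * b i + e k * d i j) *
           lam j i k powi (f i k * b j + e k * (b i * b j - d i j)))"
    (is "?x1 * ?y1 * (?x2 * ?y2) = ?x3 * ?y3 * (?x4 * ?y4)")
    if "(i, j, k) \<in> index_triples n" for i j k
  proof -
    have "?x1 * ?x2 = ?x3 * ?x4"
      using that by (intro powi_split lam) (auto simp: index_triples_def algebra_simps)
    moreover have "?y1 * ?y2 = ?y3 * ?y4"
      using that by (intro powi_split lam) (auto simp: index_triples_def algebra_simps)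
    ultimately show ?thesis by (rule quad_cong)
  qed
  have P: "lam j j k powi (d j k * a j + b k * a j * (a j - 1) div 2) *
           lam k j k powi (a k * (d j k + a j * b k) + a j * b k * (b k - 1) div 2) *
          (lam j j k powi (f j k * (a j + b j) + e k * (a j + b j) * (a j + b j - 1) div 2) *
           lam k j k powi ((a k + b k) * (f j k + (a j + b j) * e k) + (a j + b j) * e k * (e k - 1) div 2))
        = lam j j k powi ((d j k + f j k + b j * e k) * a j + (b k + e k) * a j * (a j - 1) div 2) *
           lam k j k powi (a k * (d j k + f j k + b j * e k + a j * (b k + e k)) + a j * (b k + e k) * (b k + e k - 1) div 2) *
          (lam j j k powi (f j k * b j + e k * b j * (b j - 1) div 2) *
           lam k j k powi (b k * (f j k + b j * e k) + b j * e k * (e k - 1) div 2))"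
    (is "?x1 * ?y1 * (?x2 * ?y2) = ?x3 * ?y3 * (?x4 * ?y4)")
    if "(j, k) \<in> index_pairs n" for j k
  proof -
    have "?x1 * ?x2 = ?x3 * ?x4"
      using that by (intro powi_split lam exponent_identity_j) (auto simp: index_pairs_def)
    moreover have "?y1 * ?y2 = ?y3 * ?y4"
      using that by (intro powi_split lam exponent_identity_k) (auto simp: index_pairs_def)
    ultimately show ?thesis by (rule quad_cong)
  qed
  show "sigma n lam r s * sigma n lam (r \<otimes>\<^bsub>?G\<^esub> s) t = sigma n lam r (s \<otimes>\<^bsub>?G\<^esub> t) * sigma n lam s t"
    unfolding sigma_def r s t free_nil2_def monoid.simps fst_conv snd_conv prod.case
  proof (rule quad_cong, goal_cases)
    case 1
    show ?case
      unfolding prod.distrib[symmetric]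
    proof (rule prod.cong[OF refl], goal_cases)
      case (1 x)
      obtain i j k where x: "x = (i, j, k)" by (cases x)
      with 1 have "(i, j) \<in> index_pairs n" "(i, k) \<in> index_pairs n" "(j, k) \<in> index_pairs n"
        by (auto simp: index_triples_def index_pairs_def)
      with T[of i j k] 1 show ?case unfolding x prod.case by simp
    qed
  next
    case 2
    show ?case
      unfolding prod.distrib[symmetric]
    proof (rule prod.cong[OF refl], goal_cases)
      case (1 x)
      obtain j k where x: "x = (j, k)" by (cases x)
      with P[of j k] 1 show ?case unfolding x prod.case by simp
    qed
  qed
qed

end

theory Submission
  imports Defs "HOL-Algebra.Generated_Groups"
begin

text \<open>A projective representation satisfies the relations by evaluating the cocycle on the
  generators. Conversely, let unitaries \<open>U\<^sub>i\<close>, \<open>V\<^sub>j\<^sub>k\<close> of \<open>B\<close> satisfy the relations. In the product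
  of the unitary group of \<open>B\<close> with the central extension of \<open>G(n)\<close> by the circle given by \<open>\<sigma>\<close>, the
  pairs \<open>(U\<^sub>i, u\<^sub>i)\<close> and the scalars generate a subgroup \<open>K\<close>. The relations hold in both factors with
  the same scalars, so \<open>K\<close> is obtained from the scalars by adjoining first the commutators and then
  the generators one by one, each normalizing the subgroup built before it. Reading off the exponents
  from the coordinates in \<open>G(n)\<close>, an element of \<open>K\<close> that is trivial in the second factor is a scalar,
  hence trivial. So \<open>K\<close> is the graph of a map, which is a projective representation sending \<open>u\<^sub>i\<close> to
  \<open>U\<^sub>i\<close>. Since the \<open>u\<^sub>i\<close> generate \<open>G(n)\<close>, both universal properties agree.\<close>

section \<open>Adjoining a normalizing element to a subgroup\<close>

text \<open>For infinite \<open>N\<close>, being mapped into itself by conjugation with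
  \<open>u\<close> does not imply the same for \<open>inv u\<close>. Both inclusions are demanded,
  so that negative powers of \<open>u\<close> can be moved past \<open>N\<close> as well.\<close>

definition (in group) conj_stable :: "'a \<Rightarrow> 'a set \<Rightarrow> bool" where
  "conj_stable u N \<longleftrightarrow> (\<forall>y\<in>N. u \<otimes> y \<otimes> inv u \<in> N \<and> inv u \<otimes> y \<otimes> u \<in> N)"

text \<open>This product set is the subgroup generated by \<open>N\<close> and \<open>u\<close> once
  \<open>u\<close> normalizes \<open>N\<close>. The exponent stays explicit because a coordinate
  function will determine it later.\<close>

definition (in group) adjoin :: "'a set \<Rightarrow> 'a \<Rightarrow> 'a set" where
  "adjoin N u = {y \<otimes> u [^] k | y (k :: int). y \<in> N}"

context group
begin

lemma conj_hom: "u \<in> carrier G \<Longrightarrow> (\<lambda>y. u \<otimes> y \<otimes> inv u) \<in> hom G G"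
  by (rule homI) (simp_all add: m_assoc inv_solve_left)

lemma conj_mult:
  assumes "u \<in> carrier G" "x \<in> carrier G" "y \<in> carrier G"
  shows "u \<otimes> (x \<otimes> y) \<otimes> inv u = (u \<otimes> x \<otimes> inv u) \<otimes> (u \<otimes> y \<otimes> inv u)"
  using hom_mult[OF conj_hom[OF assms(1)] assms(2,3)] .

lemma conj_int_pow:
  fixes k :: int
  assumes "u \<in> carrier G" "x \<in> carrier G"
  shows "u \<otimes> x [^] k \<otimes> inv u = (u \<otimes> x \<otimes> inv u) [^] k"
  using hom_int_pow[OF conj_hom[OF assms(1)] assms(2) is_group is_group] .

lemma conj_stable_inv: "u \<in> carrier G \<Longrightarrow> conj_stable (inv u) N \<longleftrightarrow> conj_stable u N"
  by (auto simp: conj_stable_def)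

lemma conj_stable_nat_pow:
  assumes "conj_stable u N" "N \<subseteq> carrier G" "u \<in> carrier G"
  shows "conj_stable (u [^] (k :: nat)) N"
proof (induction k)
  case 0
  show ?case using assms(2) by (auto simp: conj_stable_def)
next
  case (Suc k)
  show ?case
    unfolding conj_stable_def
  proof (intro ballI conjI)
    fix y assume y: "y \<in> N"
    have yc: "y \<in> carrier G" using y assms(2) by blast
    have "u \<otimes> y \<otimes> inv u \<in> N" using assms(1) y by (simp add: conj_stable_def)
    then have "u [^] k \<otimes> (u \<otimes> y \<otimes> inv u) \<otimes> inv (u [^] k) \<in> N"
      using Suc by (simp add: conj_stable_def)
    then show "u [^] Suc k \<otimes> y \<otimes> inv (u [^] Suc k) \<in> N"
      using yc assms(3) by (simp add: m_assoc inv_mult_group)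
    have "inv (u [^] k) \<otimes> y \<otimes> u [^] k \<in> N"
      using Suc y by (simp add: conj_stable_def)
    then have "inv u \<otimes> (inv (u [^] k) \<otimes> y \<otimes> u [^] k) \<otimes> u \<in> N"
      using assms(1) by (simp add: conj_stable_def)
    then show "inv (u [^] Suc k) \<otimes> y \<otimes> u [^] Suc k \<in> N"
      using yc assms(3) by (simp add: m_assoc inv_mult_group)
  qed
qed

lemma conj_stable_int_pow:
  assumes "conj_stable u N" "N \<subseteq> carrier G" "u \<in> carrier G"
  shows "conj_stable (u [^] (k :: int)) N"
proof (cases "k < 0")
  case True
  then have "u [^] k = inv (u [^] (nat (- k)))" by (simp only: int_pow_def2 if_True)
  then show ?thesis using conj_stable_nat_pow[OF assms] conj_stable_inv assms(3) by simp
next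
  case False
  then have "u [^] k = u [^] (nat k)" by (simp only: int_pow_def2 if_False)
  then show ?thesis using conj_stable_nat_pow[OF assms] by simp
qed

lemma subset_adjoin:
  assumes "subgroup N G" "u \<in> carrier G"
  shows "N \<subseteq> adjoin N u"
proof
  fix y assume y: "y \<in> N"
  then have "y = y \<otimes> u [^] (0 :: int)"
    using subgroup.subset[OF assms(1)] by auto
  then show "y \<in> adjoin N u" using y unfolding adjoin_def by blast
qed

lemma mult_mem_adjoin:
  assumes "y \<in> N" "u \<in> carrier G"
  shows "y \<otimes> u \<in> adjoin N u"
proof -
  have "y \<otimes> u = y \<otimes> u [^] (1 :: int)" using assms by simp
  then show ?thesis using assms(1) unfolding adjoin_def by blast
qed

lemma mem_adjoin:
  assumes "subgroup N G" "u \<in> carrier G"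
  shows "u \<in> adjoin N u"
  using mult_mem_adjoin[OF subgroup.one_closed[OF assms(1)] assms(2)] assms(2) by simp

lemma subgroup_adjoin:
  assumes N: "subgroup N G" and u: "u \<in> carrier G" and st: "conj_stable u N"
  shows "subgroup (adjoin N u) G"
proof (rule subgroupI)
  have Nc: "N \<subseteq> carrier G" using N by (rule subgroup.subset)
  note stp = conj_stable_int_pow[OF st Nc u]
  show "adjoin N u \<subseteq> carrier G" using Nc u by (auto simp: adjoin_def)
  show "adjoin N u \<noteq> {}" using mem_adjoin[OF N u] by blast
  fix x assume "x \<in> adjoin N u"
  then obtain y and k :: int where x: "y \<in> N" "x = y \<otimes> u [^] k" unfolding adjoin_def by blast
  have yc: "y \<in> carrier G" using x Nc by blast
  {
    have iy: "inv y \<in> N" using x(1) N by (simp add: subgroup.m_inv_closed)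
    have "inv (u [^] k) \<otimes> inv y \<otimes> u [^] k \<in> N"
      using stp[of k] iy by (simp add: conj_stable_def)
    \<comment> \<open>The power of \<open>u\<close> moves to the right past \<open>inv y\<close>,
      which becomes a conjugate that still lies in \<open>N\<close>.\<close>
    moreover have "inv x = (inv (u [^] k) \<otimes> inv y \<otimes> u [^] k) \<otimes> u [^] (- k)"
      unfolding x(2) using yc u by (simp add: int_pow_neg inv_mult_group m_assoc)
    ultimately show "inv x \<in> adjoin N u" unfolding adjoin_def by blast
  }
  fix x' assume "x' \<in> adjoin N u"
  then obtain y' and k' :: int where x': "y' \<in> N" "x' = y' \<otimes> u [^] k'"
    unfolding adjoin_def by blast
  have yc': "y' \<in> carrier G" using x' Nc by blast
  have "u [^] k \<otimes> y' \<otimes> inv (u [^] k) \<in> N"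
    using stp[of k] x' by (simp add: conj_stable_def)
  then have "y \<otimes> (u [^] k \<otimes> y' \<otimes> inv (u [^] k)) \<in> N"
    using x(1) N by (simp add: subgroup.m_closed)
  moreover have "x \<otimes> x' = y \<otimes> (u [^] k \<otimes> y' \<otimes> inv (u [^] k)) \<otimes> u [^] (k + k')"
    unfolding x(2) x'(2) using yc yc' u by (simp add: int_pow_mult m_assoc inv_solve_left)
  ultimately show "x \<otimes> x' \<in> adjoin N u" unfolding adjoin_def by blast
qed

text \<open>Conjugation is a homomorphism and every element is some \<open>y\<close> in
  \<open>N\<close> times a power of \<open>w\<close>, so only the conjugates of \<open>N\<close> and
  of \<open>w\<close> have to be controlled.\<close>

lemma conj_stable_adjoin:
  assumes N: "subgroup N G" and w: "w \<in> carrier G" "conj_stable w N"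
    and u: "u \<in> carrier G" "conj_stable u N"
    and uw: "u \<otimes> w \<otimes> inv u \<in> adjoin N w" "inv u \<otimes> w \<otimes> u \<in> adjoin N w"
  shows "conj_stable u (adjoin N w)"
proof -
  have sub: "subgroup (adjoin N w) G" using N w by (rule subgroup_adjoin)
  have Nc: "N \<subseteq> carrier G" using N by (rule subgroup.subset)
  \<comment> \<open>Stated for a variable \<open>v\<close>, to be applied to both \<open>u\<close>
    and \<open>inv u\<close>.\<close>
  have *: "v \<otimes> (y \<otimes> w [^] k) \<otimes> inv v \<in> adjoin N w"
    if "v \<in> carrier G" "y \<in> N" "v \<otimes> y \<otimes> inv v \<in> N" "v \<otimes> w \<otimes> inv v \<in> adjoin N w"
    for v y and k :: int
  proof -
    have "v \<otimes> (y \<otimes> w [^] k) \<otimes> inv v = (v \<otimes> y \<otimes> inv v) \<otimes> (v \<otimes> w \<otimes> inv v) [^] k"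
      using that Nc w by (subst conj_mult) (auto simp: conj_int_pow)
    also have "\<dots> \<in> adjoin N w"
      using subgroup.m_closed[OF sub _ subgroup_int_pow_closed[OF sub that(4)]]
        that(3) subset_adjoin[OF N w(1)] by (simp add: subset_eq)
    finally show ?thesis .
  qed
  show ?thesis
    unfolding conj_stable_def
  proof (intro ballI)
    fix x assume "x \<in> adjoin N w"
    then obtain y and k :: int where x: "y \<in> N" "x = y \<otimes> w [^] k" unfolding adjoin_def by blast
    have "u \<otimes> y \<otimes> inv u \<in> N" "inv u \<otimes> y \<otimes> u \<in> N"
      using u(2) x(1) by (simp_all add: conj_stable_def)
    then show "u \<otimes> x \<otimes> inv u \<in> adjoin N w \<and> inv u \<otimes> x \<otimes> u \<in> adjoin N w"
      using *[of u y k] *[of "inv u" y k] x u(1) uw by simp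
  qed
qed

text \<open>Additivity is asked only on \<open>D\<close>, because commutator coordinates are
  additive only where the first coordinates vanish.\<close>

lemma additive_int_pow:
  fixes f :: "'a \<Rightarrow> int" and k :: int
  assumes D: "subgroup D G" and f: "\<And>x y. \<lbrakk>x \<in> D; y \<in> D\<rbrakk> \<Longrightarrow> f (x \<otimes> y) = f x + f y"
    and x: "x \<in> D"
  shows "f (x [^] k) = k * f x"
proof -
  have xc: "x \<in> carrier G" using x subgroup.subset[OF D] by blast
  have f1: "f \<one> = 0" using f[of \<one> \<one>] subgroup.one_closed[OF D] by simp
  have nat: "f (x [^] m) = int m * f x \<and> x [^] m \<in> D" for m :: nat
    by (induction m) (auto simp: f1 f x subgroup.one_closed[OF D] subgroup.m_closed[OF D] algebra_simps)
  have inv: "f (inv y) = - f y" if "y \<in> D" for y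
    using f[of y "inv y"] that f1 subgroup.m_inv_closed[OF D that] subgroup.subset[OF D] by auto
  show ?thesis
  proof (cases "k < 0")
    case True
    then have "x [^] k = inv (x [^] (nat (- k)))" by (simp only: int_pow_def2 if_True)
    then show ?thesis using nat[of "nat (- k)"] inv[of "x [^] nat (- k)"] True by simp
  next
    case False
    then have "x [^] k = x [^] (nat k)" by (simp only: int_pow_def2 if_False)
    then show ?thesis using nat[of "nat k"] False by simp
  qed
qed

end

section \<open>Groups generated modulo a central subgroup by commutators\<close>

lemma finite_index_pairs: "finite (index_pairs n)"
  by (rule finite_subset[of _ "{1..n} \<times> {1..n}"]) (auto simp: index_pairs_def)

text \<open>\<open>U\<close> and \<open>V\<close> satisfy the relations of the theorem with the scalars replaced by elements
  of a central subgroup \<open>Z\<close>.\<close>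

locale central_relations = group +
  fixes Z :: "'a set" and n :: nat and U :: "nat \<Rightarrow> 'a" and V :: "nat \<times> nat \<Rightarrow> 'a"
  assumes Z_subgroup: "subgroup Z G"
    and Z_central: "\<lbrakk>z \<in> Z; x \<in> carrier G\<rbrakk> \<Longrightarrow> z \<otimes> x = x \<otimes> z"
    and U_closed: "i \<in> {1..n} \<Longrightarrow> U i \<in> carrier G"
    and V_closed: "p \<in> index_pairs n \<Longrightarrow> V p \<in> carrier G"
    and V_comm: "\<lbrakk>p \<in> index_pairs n; q \<in> index_pairs n\<rbrakk> \<Longrightarrow> V p \<otimes> V q = V q \<otimes> V p"
    and U_V: "\<lbrakk>i \<in> {1..n}; p \<in> index_pairs n\<rbrakk> \<Longrightarrow> \<exists>z\<in>Z. U i \<otimes> V p = z \<otimes> (V p \<otimes> U i)"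
    and U_U: "(j, k) \<in> index_pairs n \<Longrightarrow> U j \<otimes> U k = V (j, k) \<otimes> (U k \<otimes> U j)"
begin

text \<open>With \<open>foldr\<close> the head of the list is adjoined last, so induction on the
  list strips off the outermost element.\<close>

definition V_chain :: "(nat \<times> nat) list \<Rightarrow> 'a set" where
  "V_chain ps = foldr (\<lambda>p N. adjoin N (V p)) ps Z"

text \<open>Any enumeration will do. Distinctness means that each \<open>V p\<close> is adjoined
  once, which makes its exponent readable from a single coordinate.\<close>

definition pair_list :: "(nat \<times> nat) list" where
  "pair_list = (SOME ps. set ps = index_pairs n \<and> distinct ps)"

text \<open>The \<open>U i\<close> come on top of all \<open>V p\<close>, because exchanging two of
  them produces some \<open>V p\<close>, which the subgroup below must already contain.\<close>

primrec U_chain :: "nat \<Rightarrow> 'a set" where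
  "U_chain 0 = V_chain pair_list"
| "U_chain (Suc l) = adjoin (U_chain l) (U (Suc l))"

lemma pair_list: "set pair_list = index_pairs n" "distinct pair_list"
proof -
  have "\<exists>ps. set ps = index_pairs n \<and> distinct ps"
    using finite_index_pairs by (rule finite_distinct_list)
  from someI_ex[OF this] show "set pair_list = index_pairs n" "distinct pair_list"
    unfolding pair_list_def by blast+
qed

section \<open>Each adjoined element normalizes the chain below it\<close>

lemma conj_stable_central:
  assumes "u \<in> carrier G"
  shows "conj_stable u Z"
  unfolding conj_stable_def
proof (intro ballI conjI)
  fix y assume y: "y \<in> Z"
  have yc: "y \<in> carrier G" using y subgroup.subset[OF Z_subgroup] by blast
  have "u \<otimes> y \<otimes> inv u = y" using yc assms Z_central[OF y assms] by (metis inv_solve_right m_closed)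
  then show "u \<otimes> y \<otimes> inv u \<in> Z" using y by simp
  have "inv u \<otimes> y \<otimes> u = y"
    using yc assms Z_central[OF y, of u] by (simp add: m_assoc inv_solve_left')
  then show "inv u \<otimes> y \<otimes> u \<in> Z" using y by simp
qed

text \<open>Translates commutation up to a central factor into the two conjugates that
  \<open>conj_stable_adjoin\<close> asks for.\<close>

lemma conj_central_mult:
  assumes "u \<in> carrier G" "v \<in> carrier G" "z \<in> Z" "u \<otimes> v = z \<otimes> (v \<otimes> u)"
  shows "u \<otimes> v \<otimes> inv u = z \<otimes> v" "inv u \<otimes> v \<otimes> u = inv z \<otimes> v"
proof -
  have zc: "z \<in> carrier G" using assms(3) subgroup.subset[OF Z_subgroup] by blast
  show "u \<otimes> v \<otimes> inv u = z \<otimes> v" using assms(1,2,4) zc by (simp add: m_assoc)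
  have "inv z \<otimes> (u \<otimes> v) = v \<otimes> u"
    unfolding assms(4) using assms(1,2) zc by (simp add: inv_solve_left')
  moreover have "inv z \<otimes> u = u \<otimes> inv z"
    using Z_central[OF subgroup.m_inv_closed[OF Z_subgroup assms(3)] assms(1)] .
  ultimately have "v \<otimes> u = u \<otimes> (inv z \<otimes> v)"
    using assms(1,2) zc by (metis inv_closed m_assoc)
  then show "inv u \<otimes> v \<otimes> u = inv z \<otimes> v"
    using assms(1,2) zc by (simp add: m_assoc inv_solve_left')
qed

text \<open>Stability holds since \<open>V q\<close> and \<open>U i\<close> commute with each
  \<open>V p\<close> up to an element of \<open>Z\<close>. It is carried along for all indices, not
  just those in the list: the \<open>V q\<close> are needed for the next adjunction, the
  \<open>U i\<close> for building \<open>U_chain\<close> on top.\<close>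

lemma V_chain_invariant:
  assumes "set ps \<subseteq> index_pairs n"
  shows "subgroup (V_chain ps) G \<and> (\<forall>p\<in>set ps. V p \<in> V_chain ps) \<and> Z \<subseteq> V_chain ps \<and>
    (\<forall>p\<in>index_pairs n. conj_stable (V p) (V_chain ps)) \<and>
    (\<forall>i\<in>{1..n}. conj_stable (U i) (V_chain ps))"
  using assms
proof (induction ps)
  case Nil
  then show ?case
    using Z_subgroup by (auto simp: V_chain_def conj_stable_central U_closed V_closed)
next
  case (Cons p ps)
  let ?N = "V_chain ps"
  have eq: "V_chain (p # ps) = adjoin ?N (V p)" by (simp add: V_chain_def)
  have p: "p \<in> index_pairs n" using Cons.prems by simp
  have N: "subgroup ?N G" and ZN: "Z \<subseteq> ?N" using Cons by auto
  have Vp: "V p \<in> carrier G" "conj_stable (V p) ?N" using Cons p V_closed by auto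
  \<comment> \<open>Treats \<open>V q\<close> and \<open>U i\<close> at once, as only commutation
    with \<open>V p\<close> up to \<open>z\<close> matters.\<close>
  have stable: "conj_stable u (adjoin ?N (V p))"
    if u: "u \<in> carrier G" "conj_stable u ?N" "z \<in> Z" "u \<otimes> V p = z \<otimes> (V p \<otimes> u)" for u z
  proof (rule conj_stable_adjoin[OF N Vp u(1,2)])
    note c = conj_central_mult[OF u(1) Vp(1) u(3,4)]
    have "inv z \<in> Z" using u(3) by (rule subgroup.m_inv_closed[OF Z_subgroup])
    then have "z \<in> ?N" "inv z \<in> ?N" using u(3) ZN by auto
    then show "u \<otimes> V p \<otimes> inv u \<in> adjoin ?N (V p)" "inv u \<otimes> V p \<otimes> u \<in> adjoin ?N (V p)"
      unfolding c using Vp(1) by (auto intro: mult_mem_adjoin)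
  qed
  have "conj_stable (V q) (adjoin ?N (V p))" if q: "q \<in> index_pairs n" for q
  proof (rule stable[of _ \<one>])
    show "conj_stable (V q) ?N" using Cons q by auto
    show "V q \<otimes> V p = \<one> \<otimes> (V p \<otimes> V q)" using V_comm p q V_closed by simp
  qed (use q V_closed subgroup.one_closed[OF Z_subgroup] in auto)
  moreover have "conj_stable (U i) (adjoin ?N (V p))" if i: "i \<in> {1..n}" for i
    using U_V[OF i p] stable[of "U i"] Cons i U_closed by auto
  ultimately show ?case
    unfolding eq using Cons N ZN Vp subgroup_adjoin[OF N Vp] mem_adjoin[OF N Vp(1)]
      subset_adjoin[OF N Vp(1)] by auto
qed

text \<open>Conjugating \<open>U (Suc l)\<close> by a later \<open>U i\<close> changes it only by a
  factor from the subgroup below, made of the commutator \<open>V (Suc l, i)\<close>. Stability is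
  carried along for the elements still to be adjoined.\<close>

lemma U_chain_invariant:
  assumes "l \<le> n"
  shows "subgroup (U_chain l) G \<and> (\<forall>p\<in>index_pairs n. V p \<in> U_chain l) \<and> Z \<subseteq> U_chain l \<and>
    (\<forall>i\<in>{1..l}. U i \<in> U_chain l) \<and> (\<forall>i\<in>{l<..n}. conj_stable (U i) (U_chain l))"
  using assms
proof (induction l)
  case 0
  then show ?case using V_chain_invariant[of pair_list] pair_list by auto
next
  case (Suc l)
  let ?N = "U_chain l" and ?w = "U (Suc l)"
  have N: "subgroup ?N G" and ZN: "Z \<subseteq> ?N" and VN: "\<forall>p\<in>index_pairs n. V p \<in> ?N" using Suc by auto
  have w: "?w \<in> carrier G" "conj_stable ?w ?N" using Suc U_closed by auto
  have "conj_stable (U i) (adjoin ?N ?w)" if i: "i \<in> {Suc l<..n}" for i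
  proof (rule conj_stable_adjoin[OF N w])
    show u: "U i \<in> carrier G" "conj_stable (U i) ?N" using Suc i U_closed by auto
    \<comment> \<open>The generators are adjoined in increasing order, so the relation for this pair
      is available.\<close>
    have p: "(Suc l, i) \<in> index_pairs n" using i by (auto simp: index_pairs_def)
    let ?v = "V (Suc l, i)"
    have v: "?v \<in> ?N" "?v \<in> carrier G" using VN p V_closed by auto
    have rel: "?w \<otimes> U i = ?v \<otimes> (U i \<otimes> ?w)" using U_U[OF p] .
    have "U i \<otimes> ?w = inv ?v \<otimes> (?w \<otimes> U i)"
      unfolding rel using u v w by (simp add: inv_solve_left)
    then have "U i \<otimes> ?w \<otimes> inv (U i) = inv ?v \<otimes> ?w"
      using u v w by (simp add: m_assoc)
    then show "U i \<otimes> ?w \<otimes> inv (U i) \<in> adjoin ?N ?w"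
      using mult_mem_adjoin[OF subgroup.m_inv_closed[OF N v(1)] w(1)] by simp
    \<comment> \<open>In this direction the commutator itself appears conjugated, so stability of
      the chain below is used.\<close>
    have "inv (U i) \<otimes> ?w \<otimes> U i = (inv (U i) \<otimes> ?v \<otimes> U i) \<otimes> ?w"
      using rel u v w by (simp add: m_assoc)
    moreover have "inv (U i) \<otimes> ?v \<otimes> U i \<in> ?N" using u v by (simp add: conj_stable_def)
    ultimately show "inv (U i) \<otimes> ?w \<otimes> U i \<in> adjoin ?N ?w"
      using mult_mem_adjoin[OF _ w(1)] by simp
  qed
  moreover have "U i \<in> adjoin ?N ?w" if "i \<in> {1..Suc l}" for i
    using that Suc mem_adjoin[OF N w(1)] subset_adjoin[OF N w(1)] by (cases "i = Suc l") auto
  ultimately show ?case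
    using N ZN VN w subgroup_adjoin[OF N w] subset_adjoin[OF N w(1)] by auto
qed

lemma U_chain_subgroup: "l \<le> n \<Longrightarrow> subgroup (U_chain l) G"
  and central_subset_U_chain: "l \<le> n \<Longrightarrow> Z \<subseteq> U_chain l"
  and U_mem_U_chain: "\<lbrakk>l \<le> n; i \<in> {1..l}\<rbrakk> \<Longrightarrow> U i \<in> U_chain l"
  using U_chain_invariant by auto

section \<open>Recognizing central elements by integer coordinates\<close>

text \<open>In the application \<open>\<gamma>\<close> consists of the coordinates \<open>r\<^sub>j\<^sub>k\<close>, which are additive only where
  all coordinates \<open>r\<^sub>i\<close> vanish.\<close>

lemma mem_central_if_coordinates_0:
  fixes \<alpha> :: "nat \<Rightarrow> 'a \<Rightarrow> int" and \<gamma> :: "nat \<times> nat \<Rightarrow> 'a \<Rightarrow> int"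
  assumes \<alpha>: "\<And>i x y. \<lbrakk>x \<in> carrier G; y \<in> carrier G\<rbrakk> \<Longrightarrow> \<alpha> i (x \<otimes> y) = \<alpha> i x + \<alpha> i y"
    and \<alpha>_Z: "\<And>i z. z \<in> Z \<Longrightarrow> \<alpha> i z = 0"
    and \<alpha>_U: "\<And>i j. j \<in> {1..n} \<Longrightarrow> \<alpha> i (U j) = (if i = j then 1 else 0)"
    and \<alpha>_V: "\<And>i p. p \<in> index_pairs n \<Longrightarrow> \<alpha> i (V p) = 0"
    and \<gamma>: "\<And>p x y. \<lbrakk>x \<in> carrier G; y \<in> carrier G; \<forall>i. \<alpha> i x = 0; \<forall>i. \<alpha> i y = 0; p \<in> index_pairs n\<rbrakk>
      \<Longrightarrow> \<gamma> p (x \<otimes> y) = \<gamma> p x + \<gamma> p y"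
    and \<gamma>_Z: "\<And>p z. z \<in> Z \<Longrightarrow> \<gamma> p z = 0"
    and \<gamma>_V: "\<And>p q. q \<in> index_pairs n \<Longrightarrow> \<gamma> p (V q) = (if p = q then 1 else 0)"
    and x: "x \<in> U_chain n" "\<And>i. i \<in> {1..n} \<Longrightarrow> \<alpha> i x = 0" "\<And>p. p \<in> index_pairs n \<Longrightarrow> \<gamma> p x = 0"
  shows "x \<in> Z"
proof -
  note \<alpha>_pow = additive_int_pow[OF subgroup_self, of "\<alpha> i" for i, OF \<alpha>]
  \<comment> \<open>The common kernel of all \<alpha>, on which the \<gamma> are additive; it will
    contain the whole \<open>V_chain\<close>.\<close>
  let ?D = "{x \<in> carrier G. \<forall>i. \<alpha> i x = 0}"
  have \<alpha>_1: "\<alpha> i \<one> = 0" for i using \<alpha>[of \<one> \<one> i] by simp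
  have D: "subgroup ?D G"
  proof (rule subgroupI)
    show "inv y \<in> ?D" if "y \<in> ?D" for y
    proof -
      have "\<alpha> i (inv y) = 0" for i using that \<alpha>[of y "inv y" i] \<alpha>_1 by simp
      then show ?thesis using that by simp
    qed
    have "\<one> \<in> ?D" using \<alpha>_1 by simp
    then show "?D \<noteq> {}" by blast
  qed (auto simp: \<alpha>)
  have VD: "V p \<in> ?D" if "p \<in> index_pairs n" for p using that V_closed \<alpha>_V by simp
  have \<gamma>_pow: "\<gamma> p (V q [^] (k :: int)) = k * (if p = q then 1 else 0)"
    if "p \<in> index_pairs n" "q \<in> index_pairs n" for p q k
    using additive_int_pow[OF D, of "\<gamma> p" "V q" k] VD[OF that(2)] \<gamma> that by (simp add: \<gamma>_V)
  have V_chain_D: "V_chain ps \<subseteq> ?D" if "set ps \<subseteq> index_pairs n" for ps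
    using that
  proof (induction ps)
    case Nil
    then show ?case using subgroup.subset[OF Z_subgroup] \<alpha>_Z by (auto simp: V_chain_def)
  next
    case (Cons p ps)
    have "y \<otimes> V p [^] k \<in> ?D" if "y \<in> V_chain ps" for y and k :: int
      using Cons that VD[of p]
      by (intro subgroup.m_closed[OF D] subgroup_int_pow_closed[OF D]) auto
    then show ?case by (auto simp: V_chain_def adjoin_def)
  qed
  have V_chain_step: "y \<in> V_chain ps" "\<gamma> q (y \<otimes> V p [^] k) = \<gamma> q y + k * (if q = p then 1 else 0)"
    if "set (p # ps) \<subseteq> index_pairs n" "y \<in> V_chain ps" "q \<in> index_pairs n" for p ps y q and k :: int
  proof -
    have "y \<in> ?D" using V_chain_D[of ps] that by auto
    moreover have "V p [^] k \<in> ?D" using subgroup_int_pow_closed[OF D VD] that by auto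
    ultimately show "\<gamma> q (y \<otimes> V p [^] k) = \<gamma> q y + k * (if q = p then 1 else 0)"
      using \<gamma>[of y "V p [^] k" q] that \<gamma>_pow[of q p k] by auto
  qed (use that in auto)
  \<comment> \<open>Coordinates of pairs not yet adjoined vanish: they are 0 on \<open>Z\<close>,
    and each \<open>V p\<close> contributes to its own coordinate only.\<close>
  have \<gamma>_0: "\<gamma> q y = 0"
    if "set ps \<subseteq> index_pairs n" "q \<in> index_pairs n" "q \<notin> set ps" "y \<in> V_chain ps" for ps q y
    using that
  proof (induction ps arbitrary: y)
    case Nil
    then show ?case by (simp add: V_chain_def \<gamma>_Z)
  next
    case (Cons p ps)
    from Cons.prems(4) obtain y' and k :: int where y': "y' \<in> V_chain ps" "y = y' \<otimes> V p [^] k"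
      by (auto simp: V_chain_def adjoin_def)
    show ?case using Cons y' V_chain_step(2)[OF Cons.prems(1) y'(1) Cons.prems(2), of k] by auto
  qed
  have V_case: "y \<in> Z"
    if "set ps \<subseteq> index_pairs n" "distinct ps" "y \<in> V_chain ps" "\<And>q. q \<in> index_pairs n \<Longrightarrow> \<gamma> q y = 0"
    for ps y
    using that
  proof (induction ps)
    case Nil
    then show ?case by (simp add: V_chain_def)
  next
    case (Cons p ps)
    have p: "p \<in> index_pairs n" using Cons.prems(1) by simp
    from Cons.prems(3) obtain y' and k :: int where y': "y' \<in> V_chain ps" "y = y' \<otimes> V p [^] k"
      by (auto simp: V_chain_def adjoin_def)
    \<comment> \<open>Distinctness gives \<open>p \<notin> set ps\<close>, so the coordinate
      \<open>\<gamma> p\<close> of \<open>y\<close> is exactly the exponent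
      \<open>k\<close>.\<close>
    have "\<gamma> p y' = 0" using \<gamma>_0[of ps p y'] Cons.prems y' by auto
    then have "k = 0"
      using V_chain_step(2)[OF Cons.prems(1) y'(1) p, of k] Cons.prems(4)[OF p] y' by simp
    moreover have "y' \<in> carrier G" using V_chain_D[of ps] y' Cons.prems by auto
    ultimately have "y = y'" using y' by simp
    then show ?case using Cons y' by auto
  qed
  \<comment> \<open>Only \<open>U 1\<close> up to \<open>U l\<close> have been adjoined, and the
    \<alpha> vanish on the \<open>V_chain\<close> at the bottom.\<close>
  have \<alpha>_0: "\<alpha> i y = 0" if "l \<le> n" "l < i" "y \<in> U_chain l" for l i y
    using that
  proof (induction l arbitrary: y)
    case 0
    then show ?case using V_chain_D[of pair_list] pair_list by auto
  next
    case (Suc l)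
    from Suc.prems(3) obtain y' and k :: int where y': "y' \<in> U_chain l" "y = y' \<otimes> U (Suc l) [^] k"
      by (auto simp: adjoin_def)
    have "y' \<in> carrier G" using subgroup.subset[OF U_chain_subgroup[of l]] Suc y' by auto
    then show ?case using Suc y' U_closed[of "Suc l"] by (simp add: \<alpha> \<alpha>_pow \<alpha>_U)
  qed
  \<comment> \<open>Descends from \<open>U_chain n\<close> to the \<open>V_chain\<close>: at each
    level the exponent of the outermost \<open>U (Suc l)\<close> is the coordinate
    \<open>\<alpha> (Suc l)\<close> of \<open>x\<close>, which is 0.\<close>
  have U_case: "x \<in> V_chain pair_list" if "l \<le> n" "x \<in> U_chain l" for l
    using that
  proof (induction l)
    case 0
    then show ?case by simp
  next
    case (Suc l)
    from Suc.prems(2) obtain y' and k :: int where y': "y' \<in> U_chain l" "x = y' \<otimes> U (Suc l) [^] k"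
      by (auto simp: adjoin_def)
    have c: "y' \<in> carrier G" using subgroup.subset[OF U_chain_subgroup[of l]] Suc y' by auto
    have "\<alpha> (Suc l) y' = 0" using \<alpha>_0[of l "Suc l" y'] Suc y' by simp
    then have "k = 0"
      using x(2)[of "Suc l"] c y' Suc.prems U_closed[of "Suc l"] by (simp add: \<alpha> \<alpha>_pow \<alpha>_U)
    then have "x = y'" using y' c by simp
    then show ?case using Suc y' by auto
  qed
  show ?thesis
    using V_case[of pair_list x] U_case[of n] pair_list x by auto
qed

end

section \<open>The cocycle on the generators\<close>

lemma finite_index_triples: "finite (index_triples n)"
  by (rule finite_subset[of _ "{1..n} \<times> {1..n} \<times> {1..n}"]) (auto simp: index_triples_def)

lemma prod_eq_single:
  assumes "finite S" "\<And>x. \<lbrakk>x \<in> S; x \<noteq> a\<rbrakk> \<Longrightarrow> f x = 1"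
  shows "prod f S = (if a \<in> S then f a else 1)"
proof -
  have "prod f S = prod (\<lambda>x. if x = a then f x else 1) S"
    using assms(2) by (intro prod.cong) auto
  then show ?thesis using assms(1) by simp
qed

lemma mult_eq_1_if: "\<lbrakk>x = 1; y = 1\<rbrakk> \<Longrightarrow> x * y = (1 :: complex)"
  by simp

lemma gen_u_closed: "i \<in> {1..n} \<Longrightarrow> gen_u i \<in> carrier (free_nil2 n)"
  by (auto simp: gen_u_def free_nil2_def)

lemma gen_v_closed: "(j, k) \<in> index_pairs n \<Longrightarrow> gen_v j k \<in> carrier (free_nil2 n)"
  by (auto simp: gen_v_def free_nil2_def)

lemma sigma_gen_v_gen_v: "sigma n lam (gen_v j k) (gen_v l m) = 1"
  by (auto simp: sigma_def gen_v_def intro!: prod.neutral)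

text \<open>Every exponent contains either two different coordinates of one generator, a factor
  \<open>x * (x - 1)\<close> with \<open>x\<close> in {0, 1}, or a commutator coordinate, all of
  which are 0.\<close>

lemma sigma_gen_u_gen_u: "sigma n lam (gen_u i) (gen_u j) = 1"
  unfolding sigma_def gen_u_def prod.case
  by (intro mult_eq_1_if prod.neutral) (auto simp: index_triples_def index_pairs_def)

text \<open>At most one scalar has a nonzero exponent, and the position of \<open>i\<close> decides
  which: the triple \<open>(i, j, k)\<close> serves for \<open>i < j\<close>, the triple
  \<open>(j, i, k)\<close> for \<open>j < i < k\<close>, the pair \<open>(j, k)\<close> for
  \<open>i = j\<close> or \<open>i = k\<close>. For \<open>i > k\<close> none is left.\<close>

lemma sigma_gen_u_gen_v:
  assumes "i \<in> {1..n}" "(j, k) \<in> index_pairs n"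
  shows "sigma n lam (gen_u i) (gen_v j k) = (if i \<le> k then lam i j k else 1)"
proof -
  have 1: "(\<Prod>(i', j', k')\<in>index_triples n.
      lam i' j' k' powi ((if j' = j \<and> k' = k then 1 else 0) * (if i' = i then 1 else 0)) *
      lam j' i' k' powi ((if i' = j \<and> k' = k then 1 else 0) * (if j' = i then 1 else 0)))
    = (if i < k \<and> i \<noteq> j then lam i j k else 1)" (is "prod ?f _ = _")
  proof (cases "i < j")
    case True
    have "prod ?f (index_triples n) = (if (i, j, k) \<in> index_triples n then ?f (i, j, k) else 1)"
      by (rule prod_eq_single[OF finite_index_triples])
        (use True in \<open>auto simp: index_triples_def split: if_splits\<close>)
    then show ?thesis using True assms by (auto simp: index_triples_def index_pairs_def)
  next
    case False
    \<comment> \<open>For \<open>i = j\<close> or \<open>i \<ge> k\<close> the triple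
      \<open>(j, i, k)\<close> is not an index, and the product is 1.\<close>
    have "prod ?f (index_triples n) = (if (j, i, k) \<in> index_triples n then ?f (j, i, k) else 1)"
      by (rule prod_eq_single[OF finite_index_triples])
        (use False in \<open>auto simp: index_triples_def split: if_splits\<close>)
    then show ?thesis using False assms by (auto simp: index_triples_def index_pairs_def)
  qed
  have 2: "(\<Prod>(j', k')\<in>index_pairs n.
      lam j' j' k' powi ((if j' = j \<and> k' = k then 1 else 0) * (if j' = i then 1 else 0)) *
      lam k' j' k' powi ((if k' = i then 1 else 0) * (if j' = j \<and> k' = k then 1 else 0)))
    = (if i = j \<or> i = k then lam i j k else 1)" (is "prod ?f _ = _")
  proof -
    have "prod ?f (index_pairs n) = (if (j, k) \<in> index_pairs n then ?f (j, k) else 1)"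
      by (rule prod_eq_single[OF finite_index_pairs]) (auto split: if_splits)
    then show ?thesis using assms by (auto simp: index_pairs_def)
  qed
  have "sigma n lam (gen_u i) (gen_v j k) =
      (if i < k \<and> i \<noteq> j then lam i j k else 1) * (if i = j \<or> i = k then lam i j k else 1)"
    unfolding 1[symmetric] 2[symmetric] by (simp add: sigma_def gen_u_def gen_v_def)
  then show ?thesis using assms by (auto simp: index_pairs_def)
qed

text \<open>Only \<open>b k * c i j\<close> and its negative survive in the exponents, at the triple
  \<open>(j, k, i)\<close>, which is an index only for \<open>k < i\<close>. This factor is the
  origin of the extended scalars in \<open>lam_ext\<close>.\<close>

lemma sigma_gen_v_gen_u:
  assumes "i \<in> {1..n}" "(j, k) \<in> index_pairs n"
  shows "sigma n lam (gen_v j k) (gen_u i) = (if i \<le> k then 1 else lam j k i * inverse (lam k j i))"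
proof -
  have "(\<Prod>(i', j', k')\<in>index_triples n.
      lam i' j' k' powi ((if k' = i then 1 else 0) * (if i' = j \<and> j' = k then 1 else 0)) *
      lam j' i' k' powi ((if k' = i then 1 else 0) * - (if i' = j \<and> j' = k then 1 else 0)))
    = (if (j, k, i) \<in> index_triples n then lam j k i * inverse (lam k j i) else 1)" (is "prod ?f _ = _")
  proof -
    have "prod ?f (index_triples n) = (if (j, k, i) \<in> index_triples n then ?f (j, k, i) else 1)"
      by (rule prod_eq_single[OF finite_index_triples]) (auto split: if_splits)
    then show ?thesis by (auto simp: power_int_minus)
  qed
  then have "sigma n lam (gen_v j k) (gen_u i) =
      (if (j, k, i) \<in> index_triples n then lam j k i * inverse (lam k j i) else 1)"
    by (simp add: sigma_def gen_u_def gen_v_def case_prod_beta)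
  then show ?thesis using assms by (auto simp: index_triples_def index_pairs_def)
qed

text \<open>The left factor has just the commutator coordinate \<open>(j, k)\<close>, which the
  cocycle pairs with first coordinates of index greater than \<open>k\<close>. These vanish in the
  right factor.\<close>

lemma sigma_gen_v_gen_u_gen_u:
  assumes "(j, k) \<in> index_pairs n"
  shows "sigma n lam (gen_v j k) (gen_u k \<otimes>\<^bsub>free_nil2 n\<^esub> gen_u j) = 1"
  unfolding sigma_def gen_v_def gen_u_def free_nil2_def monoid.simps prod.case fst_conv snd_conv
  by (intro mult_eq_1_if prod.neutral)
    (use assms in \<open>auto simp: index_triples_def index_pairs_def\<close>)

section \<open>Generation of the free nilpotent group\<close>

lemma mult_free_nil2:
  "r \<otimes>\<^bsub>free_nil2 n\<^esub> s = (\<lambda>i. fst r i + fst s i,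
     \<lambda>j k. if (j, k) \<in> index_pairs n then snd r j k + snd s j k + fst r j * fst s k else 0)"
  by (simp add: free_nil2_def)

lemma one_free_nil2: "\<one>\<^bsub>free_nil2 n\<^esub> = (\<lambda>_. 0, \<lambda>_ _. 0)"
  by (simp add: free_nil2_def)

lemma gen_v_commute:
  "gen_v j k \<otimes>\<^bsub>free_nil2 n\<^esub> gen_v l m = gen_v l m \<otimes>\<^bsub>free_nil2 n\<^esub> gen_v j k"
  by (auto simp: mult_free_nil2 gen_v_def fun_eq_iff)

lemma gen_u_gen_v_commute:
  "gen_u i \<otimes>\<^bsub>free_nil2 n\<^esub> gen_v j k = gen_v j k \<otimes>\<^bsub>free_nil2 n\<^esub> gen_u i"
  by (auto simp: mult_free_nil2 gen_u_def gen_v_def fun_eq_iff)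

lemma gen_u_mult_gen_u:
  assumes "(j, k) \<in> index_pairs n"
  shows "gen_u j \<otimes>\<^bsub>free_nil2 n\<^esub> gen_u k
    = gen_v j k \<otimes>\<^bsub>free_nil2 n\<^esub> (gen_u k \<otimes>\<^bsub>free_nil2 n\<^esub> gen_u j)"
  using assms by (auto simp: mult_free_nil2 gen_u_def gen_v_def fun_eq_iff index_pairs_def)

text \<open>A two-sided induction that replaces the computation of integer powers: \<open>f\<close>
  will be the family of tuples with one varying coordinate, and \<open>g\<close> the corresponding
  generator.\<close>

lemma (in group) subgroup_int_sequence:
  fixes x :: int
  assumes S: "subgroup S G" and 0: "f 0 \<in> S" and g: "g \<in> S"
    and f: "\<And>x. f x \<in> carrier G" "\<And>x. f (x + 1) = f x \<otimes> g"
  shows "f x \<in> S"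
proof (induction x rule: int_induct[where k = 0])
  case base
  show ?case using 0 .
next
  case (step1 x)
  then show ?case using g f by (simp add: subgroup.m_closed[OF S])
next
  case (step2 x)
  have "f (x - 1) = f x \<otimes> inv g"
    using f(2)[of "x - 1"] f(1) subgroup.mem_carrier[OF S g] by (simp add: inv_solve_right)
  then show ?case using step2 g S by (simp add: subgroup.m_closed subgroup.m_inv_closed)
qed

text \<open>\<open>S\<close> contains the commutators of the \<open>gen_u i\<close>, hence all
  tuples with a single nonzero coordinate, and every tuple is a product of these in a suitable
  order.\<close>

lemma subgroup_free_nil2_eq_carrier:
  assumes S: "subgroup S (free_nil2 n)" and u: "\<And>i. i \<in> {1..n} \<Longrightarrow> gen_u i \<in> S"
  shows "S = carrier (free_nil2 n)"
proof
  interpret group "free_nil2 n" by (rule group_free_nil2)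
  note closed = subgroup.m_closed[OF S] and inv_closed' = subgroup.m_inv_closed[OF S]
  show "S \<subseteq> carrier (free_nil2 n)" using S by (rule subgroup.subset)
  have v: "gen_v j k \<in> S" if jk: "(j, k) \<in> index_pairs n" for j k
  proof -
    have uS: "gen_u j \<in> S" "gen_u k \<in> S" using u index_pairsD[OF jk] by auto
    then have uc: "gen_u j \<in> carrier (free_nil2 n)" "gen_u k \<in> carrier (free_nil2 n)"
      using subgroup.subset[OF S] by auto
    have "gen_v j k = (gen_u j \<otimes>\<^bsub>free_nil2 n\<^esub> gen_u k)
        \<otimes>\<^bsub>free_nil2 n\<^esub> inv\<^bsub>free_nil2 n\<^esub> (gen_u k \<otimes>\<^bsub>free_nil2 n\<^esub> gen_u j)"
      using gen_u_mult_gen_u[OF jk] uc gen_v_closed[OF jk] by (simp add: inv_solve_right)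
    then show ?thesis using uS by (simp add: closed inv_closed')
  qed
  have one: "(\<lambda>_. 0, \<lambda>_ _. 0) \<in> S" using subgroup.one_closed[OF S] by (simp add: one_free_nil2)
  have u_pow: "(\<lambda>l. if l = i then x else 0, \<lambda>_ _. 0) \<in> S" if i: "i \<in> {1..n}" for i and x :: int
    by (rule subgroup_int_sequence[OF S _ u[OF i], where f = "\<lambda>x. (\<lambda>l. if l = i then x else 0, \<lambda>_ _. 0)"])
      (use i one in \<open>auto simp: free_nil2_def gen_u_def fun_eq_iff index_pairs_def\<close>)
  have v_pow: "(\<lambda>_. 0, \<lambda>l m. if l = j \<and> m = k then x else 0) \<in> S"
    if jk: "(j, k) \<in> index_pairs n" for j k and x :: int
    by (rule subgroup_int_sequence[OF S _ v[OF jk],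
          where f = "\<lambda>x. (\<lambda>_. 0, \<lambda>l m. if l = j \<and> m = k then x else 0)"])
      (use jk one in \<open>auto simp: free_nil2_def gen_v_def fun_eq_iff\<close>)
  show "carrier (free_nil2 n) \<subseteq> S"
  proof
    fix r assume r: "r \<in> carrier (free_nil2 n)"
    have a: "(\<lambda>i. if i \<le> l then fst r i else 0, \<lambda>_ _. 0) \<in> S" if "l \<le> n" for l
      using that
    proof (induction l)
      case 0
      have "(\<lambda>i. if i \<le> 0 then fst r i else 0) = (\<lambda>_. 0)" using r by (auto simp: free_nil2_def)
      then show ?case using one by simp
    next
      case (Suc l)
      \<comment> \<open>The larger index stands on the left: a nonzero cross term
        \<open>fst r j * fst s k\<close> with \<open>j < k\<close> would need
        \<open>j = Suc l\<close> and \<open>k \<le> l\<close>.\<close>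
      have "(\<lambda>i. if i \<le> Suc l then fst r i else 0, \<lambda>_ _. 0)
          = (\<lambda>i. if i = Suc l then fst r (Suc l) else 0, \<lambda>_ _. 0)
            \<otimes>\<^bsub>free_nil2 n\<^esub> (\<lambda>i. if i \<le> l then fst r i else 0, \<lambda>_ _. 0)"
        by (auto simp: mult_free_nil2 fun_eq_iff index_pairs_def le_Suc_eq)
      then show ?case using closed[OF u_pow[of "Suc l" "fst r (Suc l)"] Suc.IH] Suc.prems by simp
    qed
    have c: "(\<lambda>_. 0, \<lambda>j k. if (j, k) \<in> F then snd r j k else 0) \<in> S"
      if "finite F" "F \<subseteq> index_pairs n" for F
      using that
    proof (induction F)
      case empty
      then show ?case using one by simp
    next
      case (insert p F)
      obtain j k where p: "p = (j, k)" by (cases p)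
      have "(\<lambda>_. 0, \<lambda>l m. if (l, m) \<in> insert p F then snd r l m else 0)
          = (\<lambda>_. 0, \<lambda>l m. if l = j \<and> m = k then snd r j k else 0)
            \<otimes>\<^bsub>free_nil2 n\<^esub> (\<lambda>_. 0, \<lambda>l m. if (l, m) \<in> F then snd r l m else 0)"
        using insert p by (auto simp: mult_free_nil2 fun_eq_iff)
      then show ?case using closed[OF v_pow[of j k "snd r j k"]] insert p by simp
    qed
    \<comment> \<open>The first coordinates of the commutator part are 0, so no cross terms
      arise.\<close>
    have "r = (\<lambda>_. 0, \<lambda>j k. if (j, k) \<in> index_pairs n then snd r j k else 0)
        \<otimes>\<^bsub>free_nil2 n\<^esub> (\<lambda>i. if i \<le> n then fst r i else 0, \<lambda>_ _. 0)"
      using r by (cases r) (auto simp: mult_free_nil2 free_nil2_def fun_eq_iff)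
    then show "r \<in> S" using closed[OF c[OF finite_index_pairs subset_refl] a[OF le_refl]] by simp
  qed
qed

section \<open>Unitaries and twisted extensions\<close>

context unital_cstar_algebra
begin

lemma smult_mem: "x \<in> carrier A \<Longrightarrow> c \<odot> x \<in> carrier A"
  by (rule smult_closed) (simp add: complex_field_def)

lemma smult_smult: "x \<in> carrier A \<Longrightarrow> c \<odot> (d \<odot> x) = (c * d) \<odot> x"
  using smult_assoc1[of c d x] by (simp add: complex_field_def)

lemma one_smult: "x \<in> carrier A \<Longrightarrow> 1 \<odot> x = x"
  using smult_one[of x] by (simp add: complex_field_def)

lemma adj_one: "adj A \<one> = \<one>"
proof -
  have "adj A (adj A \<one> \<otimes> \<one>) = adj A \<one> \<otimes> adj A (adj A \<one>)"
    by (rule adj_mult) (simp_all add: adj_closed)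
  then show ?thesis by (simp add: adj_closed adj_adj)
qed

lemma unitary_closed: "unitary A u \<Longrightarrow> u \<in> carrier A"
  by (simp add: unitary_def)

lemma unitary_one: "unitary A \<one>"
  by (simp add: unitary_def adj_one)

lemma unitary_adj: "unitary A u \<Longrightarrow> unitary A (adj A u)"
  by (simp add: unitary_def adj_closed adj_adj)

lemma unitary_mult:
  assumes "unitary A u" "unitary A v"
  shows "unitary A (u \<otimes> v)"
proof -
  have c: "u \<in> carrier A" "v \<in> carrier A" "adj A u \<in> carrier A" "adj A v \<in> carrier A"
    using assms by (auto simp: unitary_def adj_closed)
  have "adj A v \<otimes> adj A u \<otimes> (u \<otimes> v) = adj A v \<otimes> (adj A u \<otimes> u) \<otimes> v"
    using c by (simp only: A.m_assoc A.m_closed)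
  moreover have "u \<otimes> v \<otimes> (adj A v \<otimes> adj A u) = u \<otimes> (v \<otimes> adj A v) \<otimes> adj A u"
    using c by (simp only: A.m_assoc A.m_closed)
  ultimately show ?thesis using assms c by (simp add: unitary_def adj_mult)
qed

lemma unitary_smult:
  assumes "unitary A u" "cmod c = 1"
  shows "unitary A (c \<odot> u)"
proof -
  have "cnj c * c = 1" "c * cnj c = 1" using assms(2) by (simp_all add: complex_norm_square[symmetric] mult.commute)
  then show ?thesis
    using assms by (simp add: unitary_def smult_mem adj_closed adj_smult smult_mult_left
        smult_mult_right smult_smult one_smult)
qed

lemma inv_unitary: "unitary A u \<Longrightarrow> inv u = adj A u"
  using A.inv_unique'[of u "adj A u"] by (simp add: unitary_def adj_closed)

text \<open>The inverse of a unitary is its adjoint, so commutator relations become exchange rules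
  without inverses, the form that \<open>central_relations\<close> works with.\<close>

lemma commutator_eq_iff:
  assumes "unitary A x" "unitary A y" "w \<in> carrier A"
  shows "commutator A x y = w \<longleftrightarrow> x \<otimes> y = w \<otimes> (y \<otimes> x)"
proof -
  have c: "x \<in> carrier A" "y \<in> carrier A" "adj A x \<in> carrier A" "adj A y \<in> carrier A"
    and u: "adj A x \<otimes> x = \<one>" "x \<otimes> adj A x = \<one>" "adj A y \<otimes> y = \<one>" "y \<otimes> adj A y = \<one>"
    using assms by (auto simp: unitary_def adj_closed)
  have "x \<otimes> y \<otimes> adj A x \<otimes> adj A y \<otimes> (y \<otimes> x) = x \<otimes> y \<otimes> (adj A x \<otimes> (adj A y \<otimes> y) \<otimes> x)"
    using c by (simp only: A.m_assoc A.m_closed)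
  then have 1: "x \<otimes> y \<otimes> adj A x \<otimes> adj A y \<otimes> (y \<otimes> x) = x \<otimes> y" using c u by simp
  have "w \<otimes> (y \<otimes> x) \<otimes> adj A x \<otimes> adj A y = w \<otimes> (y \<otimes> (x \<otimes> adj A x) \<otimes> adj A y)"
    using c assms(3) by (simp only: A.m_assoc A.m_closed)
  then have 2: "w \<otimes> (y \<otimes> x) \<otimes> adj A x \<otimes> adj A y = w" using c u assms(3) by simp
  show ?thesis
    using 1 2 assms(1,2) by (auto simp: commutator_def inv_unitary)
qed

end

section \<open>The unitary group and the central extension by the circle\<close>

definition unitary_group :: "('a, 'm) cstar_scheme \<Rightarrow> 'a monoid" where
  "unitary_group A = \<lparr>carrier = {u. unitary A u}, mult = mult A, one = \<one>\<^bsub>A\<^esub>\<rparr>"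

lemma group_unitary_group:
  assumes "unital_cstar_algebra A"
  shows "group (unitary_group A)"
proof -
  interpret unital_cstar_algebra A by fact
  show ?thesis
  proof (rule groupI)
    fix x assume "x \<in> carrier (unitary_group A)"
    then have "adj A x \<in> carrier (unitary_group A)"
      "adj A x \<otimes>\<^bsub>unitary_group A\<^esub> x = \<one>\<^bsub>unitary_group A\<^esub>"
      by (simp_all add: unitary_group_def unitary_adj) (simp add: unitary_def)
    then show "\<exists>y\<in>carrier (unitary_group A). y \<otimes>\<^bsub>unitary_group A\<^esub> x = \<one>\<^bsub>unitary_group A\<^esub>"
      by blast
  qed (auto simp: unitary_group_def unitary_mult unitary_one A.m_assoc dest!: unitary_closed)
qed

text \<open>The central extension of \<open>G\<close> by the circle with cocycle \<sigma>. A
  projective representation \<open>U\<close> of \<open>G\<close> becomes an ordinary one of this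
  group, with \<open>(z, r)\<close> acting as \<open>z\<close> times \<open>U r\<close>.\<close>

definition twisted_ext :: "('g, 'm) monoid_scheme \<Rightarrow> ('g \<Rightarrow> 'g \<Rightarrow> complex) \<Rightarrow> (complex \<times> 'g) monoid" where
  "twisted_ext G \<sigma> = \<lparr>carrier = {z. cmod z = 1} \<times> carrier G,
     mult = (\<lambda>(z, r) (w, s). (z * w * \<sigma> r s, r \<otimes>\<^bsub>G\<^esub> s)), one = (1, \<one>\<^bsub>G\<^esub>)\<rparr>"

lemma cnj_mult_unimodular: "cmod z = 1 \<Longrightarrow> cnj z * z = 1"
  by (simp add: complex_norm_square[symmetric] mult.commute)

lemma group_twisted_ext:
  assumes "group G" "two_cocycle G \<sigma>"
  shows "group (twisted_ext G \<sigma>)"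
proof -
  interpret G: group G by fact
  have norm: "cmod (\<sigma> r s) = 1" if "r \<in> carrier G" "s \<in> carrier G" for r s
    using assms(2) that by (simp add: two_cocycle_def)
  have cocycle: "\<sigma> r s * \<sigma> (r \<otimes>\<^bsub>G\<^esub> s) t = \<sigma> r (s \<otimes>\<^bsub>G\<^esub> t) * \<sigma> s t"
    if "r \<in> carrier G" "s \<in> carrier G" "t \<in> carrier G" for r s t
    using assms(2) that by (simp add: two_cocycle_def)
  show ?thesis
  proof (rule groupI)
    fix x y assume "x \<in> carrier (twisted_ext G \<sigma>)" "y \<in> carrier (twisted_ext G \<sigma>)"
    then show "x \<otimes>\<^bsub>twisted_ext G \<sigma>\<^esub> y \<in> carrier (twisted_ext G \<sigma>)"
      by (auto simp: twisted_ext_def norm_mult norm)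
  next
    fix x y z assume "x \<in> carrier (twisted_ext G \<sigma>)" "y \<in> carrier (twisted_ext G \<sigma>)"
      "z \<in> carrier (twisted_ext G \<sigma>)"
    then show "x \<otimes>\<^bsub>twisted_ext G \<sigma>\<^esub> y \<otimes>\<^bsub>twisted_ext G \<sigma>\<^esub> z
        = x \<otimes>\<^bsub>twisted_ext G \<sigma>\<^esub> (y \<otimes>\<^bsub>twisted_ext G \<sigma>\<^esub> z)"
      using cocycle by (auto simp: twisted_ext_def G.m_assoc mult_ac)
  next
    fix x assume x: "x \<in> carrier (twisted_ext G \<sigma>)"
    then show "\<one>\<^bsub>twisted_ext G \<sigma>\<^esub> \<otimes>\<^bsub>twisted_ext G \<sigma>\<^esub> x = x"
      using assms(2) by (auto simp: twisted_ext_def two_cocycle_def)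
    obtain z r where [simp]: "x = (z, r)" by (cases x)
    have r: "r \<in> carrier G" "inv\<^bsub>G\<^esub> r \<in> carrier G" and z: "cmod z = 1"
      using x by (auto simp: twisted_ext_def)
    \<comment> \<open>On the unit circle the conjugate is the inverse; the second conjugate cancels
      the cocycle value of the pair.\<close>
    let ?y = "(cnj z * cnj (\<sigma> (inv\<^bsub>G\<^esub> r) r), inv\<^bsub>G\<^esub> r)"
    have "cnj z * cnj (\<sigma> (inv\<^bsub>G\<^esub> r) r) * z * \<sigma> (inv\<^bsub>G\<^esub> r) r
        = (cnj z * z) * (cnj (\<sigma> (inv\<^bsub>G\<^esub> r) r) * \<sigma> (inv\<^bsub>G\<^esub> r) r)" by (simp only: mult_ac)
    also have "\<dots> = 1" using norm[OF r(2,1)] z by (simp only: cnj_mult_unimodular mult_1)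
    finally have "?y \<otimes>\<^bsub>twisted_ext G \<sigma>\<^esub> x = \<one>\<^bsub>twisted_ext G \<sigma>\<^esub>"
      using r by (simp add: twisted_ext_def)
    moreover have "?y \<in> carrier (twisted_ext G \<sigma>)"
      using r z norm by (simp add: twisted_ext_def norm_mult)
    ultimately show "\<exists>y\<in>carrier (twisted_ext G \<sigma>). y \<otimes>\<^bsub>twisted_ext G \<sigma>\<^esub> x = \<one>\<^bsub>twisted_ext G \<sigma>\<^esub>"
      by blast
  qed (use assms(2) in \<open>auto simp: twisted_ext_def\<close>)
qed

lemma unitary_group_simps [simp]:
  "x \<in> carrier (unitary_group B) \<longleftrightarrow> unitary B x"
  "x \<otimes>\<^bsub>unitary_group B\<^esub> y = x \<otimes>\<^bsub>B\<^esub> y"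
  "\<one>\<^bsub>unitary_group B\<^esub> = \<one>\<^bsub>B\<^esub>"
  by (simp_all add: unitary_group_def)

lemma twisted_ext_simps [simp]:
  "(z, r) \<in> carrier (twisted_ext G \<sigma>) \<longleftrightarrow> cmod z = 1 \<and> r \<in> carrier G"
  "(z, r) \<otimes>\<^bsub>twisted_ext G \<sigma>\<^esub> (w, s) = (z * w * \<sigma> r s, r \<otimes>\<^bsub>G\<^esub> s)"
  "\<one>\<^bsub>twisted_ext G \<sigma>\<^esub> = (1, \<one>\<^bsub>G\<^esub>)"
  by (simp_all add: twisted_ext_def)

section \<open>Projective representations and the relations\<close>

lemma lam_ext_unimodular:
  assumes lam: "\<And>i j k. \<lbrakk>1 \<le> i; i \<le> k; 1 \<le> j; j < k; k \<le> n\<rbrakk> \<Longrightarrow> cmod (lam i j k) = 1"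
    and "i \<in> {1..n}" "(j, k) \<in> index_pairs n"
  shows "cmod (lam_ext lam i j k) = 1"
  using assms(2,3) by (auto simp: lam_ext_def lam index_pairs_def norm_mult)

text \<open>Since \<open>gen_u i\<close> and \<open>gen_v j k\<close> commute, the ratio of these
  two cocycle values will be the commutator of their images. For \<open>i \<le> k\<close> the scalar
  sits in the first value, for \<open>i > k\<close> its inverse sits in the second.\<close>

lemma sigma_gen_commute:
  assumes lam: "\<And>i j k. \<lbrakk>1 \<le> i; i \<le> k; 1 \<le> j; j < k; k \<le> n\<rbrakk> \<Longrightarrow> cmod (lam i j k) = 1"
    and ijk: "i \<in> {1..n}" "(j, k) \<in> index_pairs n"
  shows "sigma n lam (gen_u i) (gen_v j k) = lam_ext lam i j k * sigma n lam (gen_v j k) (gen_u i)"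
proof (cases "i \<le> k")
  case True
  then show ?thesis by (simp add: sigma_gen_u_gen_v[OF ijk] sigma_gen_v_gen_u[OF ijk] lam_ext_def)
next
  case False
  have l: "cmod (lam j k i) = 1" "cmod (lam k j i) = 1"
    using ijk False by (auto simp: index_pairs_def intro!: lam)
  then have "lam k j i \<noteq> 0" by auto
  then have "cnj (lam j k i) * lam k j i * (lam j k i * inverse (lam k j i))
      = cnj (lam j k i) * lam j k i" by simp
  then show ?thesis
    using False cnj_mult_unimodular[OF l(1)]
    by (simp add: sigma_gen_u_gen_v[OF ijk] sigma_gen_v_gen_u[OF ijk] lam_ext_def)
qed

lemma satisfies_relations_iff:
  assumes "unital_cstar_algebra B"
  shows "satisfies_relations n lam B U V \<longleftrightarrow>
    (\<forall>i\<in>{1..n}. unitary B (U i)) \<and>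
    (\<forall>(j, k)\<in>index_pairs n. unitary B (V j k)) \<and>
    (\<forall>(j, k)\<in>index_pairs n. \<forall>(l, m)\<in>index_pairs n.
       V j k \<otimes>\<^bsub>B\<^esub> V l m = V l m \<otimes>\<^bsub>B\<^esub> V j k) \<and>
    (\<forall>i\<in>{1..n}. \<forall>(j, k)\<in>index_pairs n.
       U i \<otimes>\<^bsub>B\<^esub> V j k = lam i j k \<odot>\<^bsub>B\<^esub> (V j k \<otimes>\<^bsub>B\<^esub> U i)) \<and>
    (\<forall>(j, k)\<in>index_pairs n. U j \<otimes>\<^bsub>B\<^esub> U k = V j k \<otimes>\<^bsub>B\<^esub> (U k \<otimes>\<^bsub>B\<^esub> U j))"
proof -
  interpret B: unital_cstar_algebra B by fact
  have 1: "commutator B x y = \<one>\<^bsub>B\<^esub> \<longleftrightarrow> x \<otimes>\<^bsub>B\<^esub> y = y \<otimes>\<^bsub>B\<^esub> x"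
    if "unitary B x" "unitary B y" for x y
    using that B.unitary_closed by (simp add: B.commutator_eq_iff)
  have 2: "commutator B x y = c \<odot>\<^bsub>B\<^esub> \<one>\<^bsub>B\<^esub> \<longleftrightarrow> x \<otimes>\<^bsub>B\<^esub> y = c \<odot>\<^bsub>B\<^esub> (y \<otimes>\<^bsub>B\<^esub> x)"
    if "unitary B x" "unitary B y" for x y c
    using that B.unitary_closed by (simp add: B.commutator_eq_iff B.smult_mem B.smult_mult_left)
  have 3: "commutator B x y = v \<longleftrightarrow> x \<otimes>\<^bsub>B\<^esub> y = v \<otimes>\<^bsub>B\<^esub> (y \<otimes>\<^bsub>B\<^esub> x)"
    if "unitary B x" "unitary B y" "unitary B v" for x y v
    using that B.unitary_closed by (simp add: B.commutator_eq_iff)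
  show ?thesis
  \<comment> \<open>The commutator is under control only for unitaries; without unitarity both sides
    are false.\<close>
  proof (cases "(\<forall>i\<in>{1..n}. unitary B (U i)) \<and> (\<forall>(j, k)\<in>index_pairs n. unitary B (V j k))")
    case True
    then have U: "unitary B (U i)" if "i \<in> {1..n}" for i using that by blast
    from True have V: "unitary B (V (fst p) (snd p))" if "p \<in> index_pairs n" for p
      using that by (auto simp: case_prod_beta)
    have p: "fst p \<in> {1..n}" "snd p \<in> {1..n}" if "p \<in> index_pairs n" for p
      using index_pairsD[of "fst p" "snd p" n] that by auto
    show ?thesis
      unfolding satisfies_relations_def case_prod_beta
      by (intro conj_cong ball_cong refl 1 2 3 U V p)
  next
    case False
    then show ?thesis unfolding satisfies_relations_def by blast
  qed
qed

section \<open>From projective representations to the relations\<close>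

lemma projective_rep_one:
  assumes "unital_cstar_algebra B" "group G" "two_cocycle G \<sigma>" "projective_unitary_rep G \<sigma> B U"
  shows "U \<one>\<^bsub>G\<^esub> = \<one>\<^bsub>B\<^esub>"
proof -
  interpret B: unital_cstar_algebra B by fact
  interpret G: group G by fact
  have u: "unitary B (U \<one>\<^bsub>G\<^esub>)" using assms(4) by (simp add: projective_unitary_rep_def)
  then have c: "U \<one>\<^bsub>G\<^esub> \<in> carrier B" "adj B (U \<one>\<^bsub>G\<^esub>) \<in> carrier B"
    by (simp_all add: unitary_def B.adj_closed)
  \<comment> \<open>A unitary idempotent is the unit.\<close>
  have "U \<one>\<^bsub>G\<^esub> \<otimes>\<^bsub>B\<^esub> U \<one>\<^bsub>G\<^esub> = U \<one>\<^bsub>G\<^esub>"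
    using assms(3,4) c by (simp add: projective_unitary_rep_def two_cocycle_def B.one_smult)
  then have "adj B (U \<one>\<^bsub>G\<^esub>) \<otimes>\<^bsub>B\<^esub> (U \<one>\<^bsub>G\<^esub> \<otimes>\<^bsub>B\<^esub> U \<one>\<^bsub>G\<^esub>) = \<one>\<^bsub>B\<^esub>"
    using u by (simp add: unitary_def)
  then show ?thesis using u c by (simp add: unitary_def B.A.m_assoc[symmetric])
qed

text \<open>The multiplication rule turns both sides of each relation into multiples of
  \<open>W\<close> at one group element, and the cocycle values on the generators supply the
  scalars.\<close>

lemma projective_rep_satisfies_relations:
  assumes B: "unital_cstar_algebra B"
    and lam: "\<And>i j k. \<lbrakk>1 \<le> i; i \<le> k; 1 \<le> j; j < k; k \<le> n\<rbrakk> \<Longrightarrow> cmod (lam i j k) = 1"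
    and W: "projective_unitary_rep (free_nil2 n) (sigma n lam) B W"
  shows "satisfies_relations n (lam_ext lam) B (\<lambda>i. W (gen_u i)) (\<lambda>j k. W (gen_v j k))"
proof -
  interpret B: unital_cstar_algebra B by fact
  interpret group "free_nil2 n" by (rule group_free_nil2)
  have mult: "W r \<otimes>\<^bsub>B\<^esub> W s = sigma n lam r s \<odot>\<^bsub>B\<^esub> W (r \<otimes>\<^bsub>free_nil2 n\<^esub> s)"
    if "r \<in> carrier (free_nil2 n)" "s \<in> carrier (free_nil2 n)" for r s
    using W that by (simp add: projective_unitary_rep_def)
  have unit: "unitary B (W r)" if "r \<in> carrier (free_nil2 n)" for r
    using W that by (simp add: projective_unitary_rep_def)
  note closed = B.unitary_closed[OF unit]
  have vv: "W (gen_v j k) \<otimes>\<^bsub>B\<^esub> W (gen_v l m) = W (gen_v l m) \<otimes>\<^bsub>B\<^esub> W (gen_v j k)"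
    if "(j, k) \<in> index_pairs n" "(l, m) \<in> index_pairs n" for j k l m
    using that by (simp add: mult gen_v_closed sigma_gen_v_gen_v) (simp add: gen_v_commute[of n j k l m])
  have uv: "W (gen_u i) \<otimes>\<^bsub>B\<^esub> W (gen_v j k)
      = lam_ext lam i j k \<odot>\<^bsub>B\<^esub> (W (gen_v j k) \<otimes>\<^bsub>B\<^esub> W (gen_u i))"
    if "i \<in> {1..n}" "(j, k) \<in> index_pairs n" for i j k
    using that by (simp add: mult gen_u_closed gen_v_closed B.smult_smult closed
        sigma_gen_commute[OF lam] gen_u_gen_v_commute[of n i j k])
  have uu: "W (gen_u j) \<otimes>\<^bsub>B\<^esub> W (gen_u k)
      = W (gen_v j k) \<otimes>\<^bsub>B\<^esub> (W (gen_u k) \<otimes>\<^bsub>B\<^esub> W (gen_u j))"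
    if jk: "(j, k) \<in> index_pairs n" for j k
    using index_pairsD[OF jk] gen_v_closed[OF jk]
    by (simp add: mult gen_u_closed sigma_gen_u_gen_u B.one_smult closed
        sigma_gen_v_gen_u_gen_u jk gen_u_mult_gen_u)
  show ?thesis
    unfolding satisfies_relations_iff[OF B]
    by (intro conjI ballI)
      (auto simp del: atLeastAtMost_iff One_nat_def intro: vv uv uu unit gen_u_closed gen_v_closed)
qed

section \<open>From the relations to a projective representation\<close>

lemma exists_projective_rep:
  assumes B: "unital_cstar_algebra B"
    and lam: "\<And>i j k. \<lbrakk>1 \<le> i; i \<le> k; 1 \<le> j; j < k; k \<le> n\<rbrakk> \<Longrightarrow> cmod (lam i j k) = 1"
    and rel: "satisfies_relations n (lam_ext lam) B U V"
  obtains W where "projective_unitary_rep (free_nil2 n) (sigma n lam) B W"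
    and "\<And>i. i \<in> {1..n} \<Longrightarrow> W (gen_u i) = U i"
    and "\<And>j k. (j, k) \<in> index_pairs n \<Longrightarrow> W (gen_v j k) = V j k"
proof -
  interpret B: unital_cstar_algebra B by fact
  define G where "G = free_nil2 n"
  define \<sigma> where "\<sigma> = sigma n lam"
  define H where "H = unitary_group B \<times>\<times> twisted_ext G \<sigma>"
  \<comment> \<open>The scalars are embedded diagonally, with the same \<open>z\<close> in both
    factors, so an element of \<open>Z\<close> with circle coordinate 1 is trivial.\<close>
  define Z where "Z = (\<lambda>z. (z \<odot>\<^bsub>B\<^esub> \<one>\<^bsub>B\<^esub>, z, \<one>\<^bsub>G\<^esub>)) ` {z. cmod z = 1}"
  define u where "u = (\<lambda>i. (U i, 1 :: complex, gen_u i))"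
  define v where "v = (\<lambda>p. (V (fst p) (snd p), 1 :: complex, gen_v (fst p) (snd p)))"
  \<comment> \<open>Together, \<alpha> and \<gamma> are the coordinates of the component in
    G(n).\<close>
  define \<alpha> :: "nat \<Rightarrow> 'a \<times> complex \<times> tuple \<Rightarrow> int" where "\<alpha> = (\<lambda>i x. fst (snd (snd x)) i)"
  define \<gamma> :: "nat \<times> nat \<Rightarrow> 'a \<times> complex \<times> tuple \<Rightarrow> int"
    where "\<gamma> = (\<lambda>p x. snd (snd (snd x)) (fst p) (snd p))"
  have cocycle: "two_cocycle G \<sigma>"
    unfolding G_def \<sigma>_def by (rule two_cocycle_sigma) (rule lam)
  have \<sigma>_norm: "cmod (\<sigma> r s) = 1" if "r \<in> carrier G" "s \<in> carrier G" for r s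
    using cocycle that by (simp add: two_cocycle_def)
  have \<sigma>_one: "\<sigma> r \<one>\<^bsub>G\<^esub> = 1" "\<sigma> \<one>\<^bsub>G\<^esub> r = 1" if "r \<in> carrier G" for r
    using cocycle that by (auto simp: two_cocycle_def)
  have G: "group G" unfolding G_def by (rule group_free_nil2)
  interpret G: group G by (rule G)
  interpret UB: group "unitary_group B" using B by (rule group_unitary_group)
  interpret H: group H
    unfolding H_def using G cocycle by (intro DirProd_group group_unitary_group B group_twisted_ext)
  have H_carrier: "(b, z, r) \<in> carrier H \<longleftrightarrow> unitary B b \<and> cmod z = 1 \<and> r \<in> carrier G" for b z r
    by (simp add: H_def)
  have H_mult: "(b, z, r) \<otimes>\<^bsub>H\<^esub> (b', z', r') = (b \<otimes>\<^bsub>B\<^esub> b', z * z' * \<sigma> r r', r \<otimes>\<^bsub>G\<^esub> r')"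
    for b b' z z' r r' by (simp add: H_def)
  have H_one: "\<one>\<^bsub>H\<^esub> = (\<one>\<^bsub>B\<^esub>, 1, \<one>\<^bsub>G\<^esub>)" by (simp add: H_def)
  note rels = rel[unfolded satisfies_relations_iff[OF B]]
  have U: "unitary B (U i)" "gen_u i \<in> carrier G" if "i \<in> {1..n}" for i
    using rels gen_u_closed[OF that] that by (auto simp: G_def)
  have V: "unitary B (V j k)" "gen_v j k \<in> carrier G" if "(j, k) \<in> index_pairs n" for j k
    using rels gen_v_closed[OF that] that by (auto simp: G_def)
  interpret C: central_relations H Z n u v
  proof (intro central_relations.intro central_relations_axioms.intro H.is_group)
    have inv: "(cnj z \<odot>\<^bsub>B\<^esub> \<one>\<^bsub>B\<^esub>, cnj z, \<one>\<^bsub>G\<^esub>) \<otimes>\<^bsub>H\<^esub> (z \<odot>\<^bsub>B\<^esub> \<one>\<^bsub>B\<^esub>, z, \<one>\<^bsub>G\<^esub>) = \<one>\<^bsub>H\<^esub>"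
      if "cmod z = 1" for z
      using that by (simp add: H_mult H_one B.smult_mult_left B.smult_mem B.smult_smult
          cnj_mult_unimodular B.one_smult \<sigma>_one)
    show "subgroup Z H"
    proof (rule H.subgroupI)
      show sub: "Z \<subseteq> carrier H"
        unfolding Z_def by (rule image_subsetI) (simp add: H_carrier B.unitary_smult B.unitary_one)
      show "Z \<noteq> {}" by (auto simp: Z_def intro: exI[of _ 1])
      fix x assume x: "x \<in> Z"
      then obtain z where z: "cmod z = 1" "x = (z \<odot>\<^bsub>B\<^esub> \<one>\<^bsub>B\<^esub>, z, \<one>\<^bsub>G\<^esub>)" by (auto simp: Z_def)
      let ?y = "(cnj z \<odot>\<^bsub>B\<^esub> \<one>\<^bsub>B\<^esub>, cnj z, \<one>\<^bsub>G\<^esub>)"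
      have y: "?y \<in> Z" using z by (auto simp: Z_def)
      have "inv\<^bsub>H\<^esub> x = ?y"
        using inv[OF z(1)] x y sub z(2) by (intro H.inv_equality) auto
      then show "inv\<^bsub>H\<^esub> x \<in> Z" using y by simp
      fix x' assume "x' \<in> Z"
      then obtain z' where z': "cmod z' = 1" "x' = (z' \<odot>\<^bsub>B\<^esub> \<one>\<^bsub>B\<^esub>, z', \<one>\<^bsub>G\<^esub>)"
        by (auto simp: Z_def)
      have "x \<otimes>\<^bsub>H\<^esub> x' = ((z * z') \<odot>\<^bsub>B\<^esub> \<one>\<^bsub>B\<^esub>, z * z', \<one>\<^bsub>G\<^esub>)"
        using z z' by (simp add: H_mult B.smult_mult_left B.smult_mem B.smult_smult \<sigma>_one)
      then show "x \<otimes>\<^bsub>H\<^esub> x' \<in> Z" using z z' by (auto simp: Z_def norm_mult)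
    qed
    show "z \<otimes>\<^bsub>H\<^esub> x = x \<otimes>\<^bsub>H\<^esub> z" if "z \<in> Z" "x \<in> carrier H" for z x
      using that by (cases x) (auto simp: Z_def H_mult H_carrier B.smult_mult_left
          B.smult_mult_right B.unitary_closed \<sigma>_one)
    show "u i \<in> carrier H" if "i \<in> {1..n}" for i
      using U[OF that] by (simp add: u_def H_carrier)
    show "v p \<in> carrier H" if "p \<in> index_pairs n" for p
      using V[of "fst p" "snd p"] that by (simp add: v_def H_carrier)
    show "v p \<otimes>\<^bsub>H\<^esub> v q = v q \<otimes>\<^bsub>H\<^esub> v p" if "p \<in> index_pairs n" "q \<in> index_pairs n" for p q
      using rels that gen_v_commute[of n "fst p" "snd p" "fst q" "snd q"]
      by (cases p; cases q) (auto simp: v_def H_mult \<sigma>_def G_def sigma_gen_v_gen_v)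
    \<comment> \<open>The exchange scalar is the same in both factors, by the relation in
      \<open>B\<close> and by the cocycle values in the extension, so one diagonal element serves
      for both.\<close>
    show "\<exists>z\<in>Z. u i \<otimes>\<^bsub>H\<^esub> v p = z \<otimes>\<^bsub>H\<^esub> (v p \<otimes>\<^bsub>H\<^esub> u i)"
      if i: "i \<in> {1..n}" and p: "p \<in> index_pairs n" for i p
    proof -
      obtain j k where jk: "p = (j, k)" by (cases p)
      note p' = p[unfolded jk]
      let ?l = "lam_ext lam i j k"
      have "cmod ?l = 1" using lam i p' by (rule lam_ext_unimodular)
      then have "(?l \<odot>\<^bsub>B\<^esub> \<one>\<^bsub>B\<^esub>, ?l, \<one>\<^bsub>G\<^esub>) \<in> Z" by (auto simp: Z_def)
      moreover have "U i \<otimes>\<^bsub>B\<^esub> V j k = ?l \<odot>\<^bsub>B\<^esub> (V j k \<otimes>\<^bsub>B\<^esub> U i)" using rels i p' by blast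
      moreover have "\<sigma> (gen_u i) (gen_v j k) = ?l * \<sigma> (gen_v j k) (gen_u i)"
        unfolding \<sigma>_def using lam i p' by (rule sigma_gen_commute)
      moreover have "gen_u i \<otimes>\<^bsub>G\<^esub> gen_v j k = gen_v j k \<otimes>\<^bsub>G\<^esub> gen_u i"
        unfolding G_def by (rule gen_u_gen_v_commute)
      ultimately have "u i \<otimes>\<^bsub>H\<^esub> v p = (?l \<odot>\<^bsub>B\<^esub> \<one>\<^bsub>B\<^esub>, ?l, \<one>\<^bsub>G\<^esub>) \<otimes>\<^bsub>H\<^esub> (v p \<otimes>\<^bsub>H\<^esub> u i)"
        using U[OF i] V[OF p']
        by (simp add: u_def v_def jk H_mult B.smult_mult_left B.unitary_closed \<sigma>_one)
      then show ?thesis using \<open>_ \<in> Z\<close> by blast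
    qed
    \<comment> \<open>All cocycle values involved are 1, so no scalar appears.\<close>
    show "u j \<otimes>\<^bsub>H\<^esub> u k = v (j, k) \<otimes>\<^bsub>H\<^esub> (u k \<otimes>\<^bsub>H\<^esub> u j)" if jk: "(j, k) \<in> index_pairs n" for j k
    proof -
      have "U j \<otimes>\<^bsub>B\<^esub> U k = V j k \<otimes>\<^bsub>B\<^esub> (U k \<otimes>\<^bsub>B\<^esub> U j)" using rels jk by blast
      then show ?thesis
        using gen_u_mult_gen_u[OF jk]
        by (simp add: u_def v_def H_mult \<sigma>_def G_def sigma_gen_u_gen_u
            sigma_gen_v_gen_u_gen_u[OF jk])
    qed
  qed
  define K where "K = C.U_chain n"
  have K: "subgroup K H" unfolding K_def by (rule C.U_chain_subgroup) simp
  have ZK: "Z \<subseteq> K" unfolding K_def by (rule C.central_subset_U_chain) simp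
  have uK: "u i \<in> K" if "i \<in> {1..n}" for i
    unfolding K_def by (rule C.U_mem_U_chain) (use that in simp_all)
  \<comment> \<open>All coordinates of the unit of G(n) are 0, which puts the element into
    \<open>Z\<close>; its circle coordinate 1 then forces \<open>b\<close> to be the unit.\<close>
  have kernel: "b = \<one>\<^bsub>B\<^esub>" if "(b, 1, \<one>\<^bsub>G\<^esub>) \<in> K" for b
  proof -
    have "(b, 1, \<one>\<^bsub>G\<^esub>) \<in> Z"
    proof (rule C.mem_central_if_coordinates_0[of \<alpha> \<gamma>])
      show "\<alpha> i (x \<otimes>\<^bsub>H\<^esub> y) = \<alpha> i x + \<alpha> i y" for i x y
        by (cases x; cases y) (simp add: \<alpha>_def H_mult G_def mult_free_nil2)
      show "\<gamma> p (x \<otimes>\<^bsub>H\<^esub> y) = \<gamma> p x + \<gamma> p y"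
        if "\<forall>i. \<alpha> i x = 0" "\<forall>i. \<alpha> i y = 0" "p \<in> index_pairs n" for p x y
        using that by (cases x; cases y) (simp add: \<alpha>_def \<gamma>_def H_mult G_def mult_free_nil2)
      show "(b, 1, \<one>\<^bsub>G\<^esub>) \<in> C.U_chain n" using that by (simp add: K_def)
    qed (auto simp: \<alpha>_def \<gamma>_def Z_def u_def v_def gen_u_def gen_v_def G_def one_free_nil2)
    then show ?thesis by (auto simp: Z_def B.one_smult)
  qed
  \<comment> \<open>The quotient of two elements with equal second factor lies in \<open>K\<close>
    over the unit of the extension, where \<open>kernel\<close> applies.\<close>
  have uniq: "b = b'" if b: "(b, z, r) \<in> K" and b': "(b', z, r) \<in> K" for b b' z r
  proof -
    have c: "(b, z, r) \<in> carrier H" "(b', z, r) \<in> carrier H"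
      using b b' subgroup.subset[OF K] by auto
    then have u: "unitary B b" "unitary B b'" and e: "(z, r) \<in> carrier (twisted_ext G \<sigma>)"
      by (simp_all add: H_carrier)
    interpret E: group "twisted_ext G \<sigma>" using G cocycle by (rule group_twisted_ext)
    have "inv\<^bsub>H\<^esub> (b', z, r) = (inv\<^bsub>unitary_group B\<^esub> b', inv\<^bsub>twisted_ext G \<sigma>\<^esub> (z, r))"
      unfolding H_def using u e by (intro inv_DirProd) (auto intro: UB.is_group E.is_group)
    then have "(b, z, r) \<otimes>\<^bsub>H\<^esub> inv\<^bsub>H\<^esub> (b', z, r) = (b \<otimes>\<^bsub>B\<^esub> inv\<^bsub>unitary_group B\<^esub> b', 1, \<one>\<^bsub>G\<^esub>)"
      using E.r_inv[OF e] by (simp add: H_def del: twisted_ext_simps(2))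
    moreover have "(b, z, r) \<otimes>\<^bsub>H\<^esub> inv\<^bsub>H\<^esub> (b', z, r) \<in> K"
      using b b' by (intro subgroup.m_closed[OF K] subgroup.m_inv_closed[OF K])
    ultimately have "b \<otimes>\<^bsub>unitary_group B\<^esub> inv\<^bsub>unitary_group B\<^esub> b' = \<one>\<^bsub>unitary_group B\<^esub>"
      using kernel by simp
    moreover have "b \<in> carrier (unitary_group B)" "b' \<in> carrier (unitary_group B)" using u by simp_all
    ultimately show ?thesis by (metis UB.inv_closed UB.inv_equality UB.inv_inv)
  qed
  \<comment> \<open>Multiplying by the diagonal scalar \<open>cnj z\<close>, which lies in
    \<open>K\<close>, normalizes the circle coordinate to 1.\<close>
  have rescale: "(cnj z \<odot>\<^bsub>B\<^esub> b, 1, r) \<in> K" if b: "(b, z, r) \<in> K" for b z r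
  proof -
    have c: "unitary B b" "cmod z = 1" "r \<in> carrier G"
      using subgroup.mem_carrier[OF K b] by (simp_all add: H_carrier)
    have "(cnj z \<odot>\<^bsub>B\<^esub> \<one>\<^bsub>B\<^esub>, cnj z, \<one>\<^bsub>G\<^esub>) \<in> K" using ZK c(2) by (auto simp: Z_def)
    then have "(cnj z \<odot>\<^bsub>B\<^esub> \<one>\<^bsub>B\<^esub>, cnj z, \<one>\<^bsub>G\<^esub>) \<otimes>\<^bsub>H\<^esub> (b, z, r) \<in> K"
      using b by (rule subgroup.m_closed[OF K])
    then show ?thesis
      using c by (simp add: H_mult B.smult_mult_left B.unitary_closed cnj_mult_unimodular \<sigma>_one)
  qed
  \<comment> \<open>The image of \<open>K\<close> in G(n) is a subgroup containing every
    \<open>gen_u i\<close>, hence all of G(n).\<close>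
  have "group_hom H G (\<lambda>x. snd (snd x))"
    by (intro group_hom.intro group_hom_axioms.intro homI H.is_group G)
      (auto simp: H_carrier H_mult)
  then have "subgroup ((\<lambda>x. snd (snd x)) ` K) G"
    using K by (rule group_hom.subgroup_img_is_subgroup)
  then have "(\<lambda>x. snd (snd x)) ` K = carrier G"
    unfolding G_def
  proof (rule subgroup_free_nil2_eq_carrier)
    show "gen_u i \<in> (\<lambda>x. snd (snd x)) ` K" if "i \<in> {1..n}" for i
      using uK[OF that] by (force simp: u_def)
  qed
  then have img: "carrier G \<subseteq> (\<lambda>x. snd (snd x)) ` K" by (rule equalityD2)
  have surj: "\<exists>b. (b, 1, r) \<in> K" if "r \<in> carrier G" for r
  proof -
    from subsetD[OF img that] obtain x where "x \<in> K" "r = snd (snd x)" by (rule imageE)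
    then have "(fst x, fst (snd x), r) \<in> K" by simp
    from rescale[OF this] show ?thesis by (rule exI)
  qed
  \<comment> \<open>For \<open>r\<close> in the carrier the choice is unique by \<open>uniq\<close>,
    so the points with circle coordinate 1 in \<open>K\<close> form the graph of
    \<open>W\<close>.\<close>
  define W where "W = (\<lambda>r. SOME b. (b, 1 :: complex, r) \<in> K)"
  have WK: "(W r, 1, r) \<in> K" if "r \<in> carrier G" for r
    using someI_ex[OF surj[OF that]] by (simp add: W_def)
  have W_unitary: "unitary B (W r)" if "r \<in> carrier G" for r
    using subgroup.mem_carrier[OF K WK[OF that]] by (simp add: H_carrier)
  have rep: "projective_unitary_rep G \<sigma> B W"
    unfolding projective_unitary_rep_def
  proof (intro conjI ballI W_unitary)
    fix r s assume rs: "r \<in> carrier G" "s \<in> carrier G"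
    have "(W r, 1, r) \<otimes>\<^bsub>H\<^esub> (W s, 1, s) \<in> K" using rs by (intro subgroup.m_closed[OF K] WK)
    \<comment> \<open>The product has circle coordinate \<open>\<sigma> r s\<close>; scaled back to
      1, it must be the point of the graph over the product of \<open>r\<close> and
      \<open>s\<close>.\<close>
    then have "(cnj (\<sigma> r s) \<odot>\<^bsub>B\<^esub> (W r \<otimes>\<^bsub>B\<^esub> W s), 1, r \<otimes>\<^bsub>G\<^esub> s) \<in> K"
      by (intro rescale) (simp add: H_mult)
    then have eq: "cnj (\<sigma> r s) \<odot>\<^bsub>B\<^esub> (W r \<otimes>\<^bsub>B\<^esub> W s) = W (r \<otimes>\<^bsub>G\<^esub> s)"
      by (rule uniq) (use rs WK in simp)
    have c: "W r \<otimes>\<^bsub>B\<^esub> W s \<in> carrier B"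
      by (intro B.unitary_closed B.unitary_mult W_unitary rs)
    have "W r \<otimes>\<^bsub>B\<^esub> W s = (\<sigma> r s * cnj (\<sigma> r s)) \<odot>\<^bsub>B\<^esub> (W r \<otimes>\<^bsub>B\<^esub> W s)"
      using cnj_mult_unimodular[OF \<sigma>_norm[OF rs]] c by (simp add: mult.commute B.one_smult)
    then show "W r \<otimes>\<^bsub>B\<^esub> W s = \<sigma> r s \<odot>\<^bsub>B\<^esub> W (r \<otimes>\<^bsub>G\<^esub> s)"
      unfolding eq[symmetric] B.smult_smult[OF c] .
  qed
  have W_u: "W (gen_u i) = U i" if "i \<in> {1..n}" for i
    using uniq[OF WK[OF U(2)[OF that]]] uK[OF that] by (simp add: u_def)
  \<comment> \<open>Both families satisfy the relations, so the values at \<open>gen_v j k\<close>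
    are forced: they are commutators of the values already known.\<close>
  have "satisfies_relations n (lam_ext lam) B (\<lambda>i. W (gen_u i)) (\<lambda>j k. W (gen_v j k))"
    using B lam rep unfolding G_def \<sigma>_def by (rule projective_rep_satisfies_relations)
  then have "W (gen_v j k) = V j k" if "(j, k) \<in> index_pairs n" for j k
    using rel W_u index_pairsD[OF that] that unfolding satisfies_relations_def
    by (metis (mono_tags, lifting) case_prodD)
  with rep W_u that show ?thesis unfolding G_def \<sigma>_def by blast
qed

section \<open>The universal properties\<close>

text \<open>The elements with value in \<open>T\<close> form a subgroup, because up to scalars
  \<open>W\<close> turns products into products and inverses into adjoints. \<open>T\<close> is only
  a set with these closure properties, so that it can be a closed star subalgebra as well as the set
  where two homomorphisms agree. Nonemptiness comes from \<open>gen_u 1\<close>.\<close>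

lemma projective_rep_mem_star_closed:
  assumes A: "unital_cstar_algebra A" and "two_cocycle (free_nil2 n) \<sigma>"
    and W: "projective_unitary_rep (free_nil2 n) \<sigma> A W"
    and mult: "\<And>x y. \<lbrakk>x \<in> T; y \<in> T\<rbrakk> \<Longrightarrow> x \<otimes>\<^bsub>A\<^esub> y \<in> T"
    and smult: "\<And>c x. x \<in> T \<Longrightarrow> c \<odot>\<^bsub>A\<^esub> x \<in> T"
    and adj: "\<And>x. x \<in> T \<Longrightarrow> adj A x \<in> T"
    and gen: "n \<ge> 1" "\<And>i. i \<in> {1..n} \<Longrightarrow> W (gen_u i) \<in> T"
    and r: "r \<in> carrier (free_nil2 n)"
  shows "W r \<in> T"
proof -
  interpret A: unital_cstar_algebra A by fact
  define G where "G = free_nil2 n"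
  interpret G: group G unfolding G_def by (rule group_free_nil2)
  have W_mult: "W r \<otimes>\<^bsub>A\<^esub> W s = \<sigma> r s \<odot>\<^bsub>A\<^esub> W (r \<otimes>\<^bsub>G\<^esub> s)" and \<sigma>: "cmod (\<sigma> r s) = 1"
    if "r \<in> carrier G" "s \<in> carrier G" for r s
    using assms(2) W that by (auto simp: projective_unitary_rep_def two_cocycle_def G_def)
  have unit: "unitary A (W r)" if "r \<in> carrier G" for r
    using W that by (simp add: projective_unitary_rep_def G_def)
  note closed = A.unitary_closed[OF unit]
  have one: "W \<one>\<^bsub>G\<^esub> = \<one>\<^bsub>A\<^esub>"
    using A G.is_group assms(2) W unfolding G_def by (rule projective_rep_one)
  have "subgroup {r \<in> carrier G. W r \<in> T} G"
  proof (rule G.subgroupI)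
    have "W (gen_u 1) \<in> T" "gen_u 1 \<in> carrier G" using gen gen_u_closed[of 1 n] by (auto simp: G_def)
    then show "{r \<in> carrier G. W r \<in> T} \<noteq> {}" by blast
  next
    fix r assume "r \<in> {r \<in> carrier G. W r \<in> T}"
    then have r: "r \<in> carrier G" "inv\<^bsub>G\<^esub> r \<in> carrier G" "W r \<in> T" by auto
    let ?a = "adj A (W r)"
    have a: "?a \<in> carrier A" "W r \<otimes>\<^bsub>A\<^esub> ?a = \<one>\<^bsub>A\<^esub>"
      using unit[OF r(1)] by (auto simp: unitary_def A.adj_closed)
    have "W (inv\<^bsub>G\<^esub> r) = W (inv\<^bsub>G\<^esub> r) \<otimes>\<^bsub>A\<^esub> (W r \<otimes>\<^bsub>A\<^esub> ?a)"
      using r closed a by simp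
    also have "\<dots> = (W (inv\<^bsub>G\<^esub> r) \<otimes>\<^bsub>A\<^esub> W r) \<otimes>\<^bsub>A\<^esub> ?a"
      using r closed a by (simp only: A.A.m_assoc)
    also have "\<dots> = \<sigma> (inv\<^bsub>G\<^esub> r) r \<odot>\<^bsub>A\<^esub> ?a"
      using r a by (simp add: W_mult one A.smult_mult_left)
    finally show "inv\<^bsub>G\<^esub> r \<in> {r \<in> carrier G. W r \<in> T}" using r adj smult by simp
  next
    fix r s assume "r \<in> {r \<in> carrier G. W r \<in> T}" "s \<in> {r \<in> carrier G. W r \<in> T}"
    then have rs: "r \<in> carrier G" "s \<in> carrier G" "W r \<in> T" "W s \<in> T" by auto
    have "W (r \<otimes>\<^bsub>G\<^esub> s) = cnj (\<sigma> r s) \<odot>\<^bsub>A\<^esub> (W r \<otimes>\<^bsub>A\<^esub> W s)"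
      using rs by (simp add: W_mult A.smult_smult closed cnj_mult_unimodular \<sigma> A.one_smult)
    then show "r \<otimes>\<^bsub>G\<^esub> s \<in> {r \<in> carrier G. W r \<in> T}" using rs mult smult by simp
  qed auto
  then have "{r \<in> carrier G. W r \<in> T} = carrier G"
    unfolding G_def by (rule subgroup_free_nil2_eq_carrier) (use gen gen_u_closed in auto)
  then show ?thesis using r by (auto simp: G_def)
qed

theorem theorem3p1:
  fixes n :: nat
    and lam :: "nat \<Rightarrow> nat \<Rightarrow> nat \<Rightarrow> complex"
    and A :: "'a cstar"
    and \<iota> :: "tuple \<Rightarrow> 'a"
  assumes "n \<ge> 2"
    and "\<And>i j k. \<lbrakk>1 \<le> i; i \<le> k; 1 \<le> j; j < k; k \<le> n\<rbrakk> \<Longrightarrow> cmod (lam i j k) = 1"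
    and "is_twisted_group_cstar TYPE('b) (free_nil2 n) (sigma n lam) A \<iota>"
  shows "is_universal_cstar TYPE('b) n (lam_ext lam) A
           (\<lambda>i. \<iota> (gen_u i)) (\<lambda>j k. \<iota> (gen_v j k))"
proof -
  let ?G = "free_nil2 n" and ?\<sigma> = "sigma n lam"
  note lam = assms(2)
  have A: "unital_cstar_algebra A" and \<iota>: "projective_unitary_rep ?G ?\<sigma> A \<iota>"
    and gen: "cstar_generated_by A (\<iota> ` carrier ?G)"
    and univ: "\<And>(B :: 'b cstar) W. \<lbrakk>unital_cstar_algebra B; projective_unitary_rep ?G ?\<sigma> B W\<rbrakk>
      \<Longrightarrow> \<exists>!\<phi>. \<phi> \<in> star_hom A B \<and> (\<forall>r\<in>carrier ?G. \<phi> (\<iota> r) = W r)"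
    using assms(3) unfolding is_twisted_group_cstar_def by blast+
  interpret A: unital_cstar_algebra A by (rule A)
  have cocycle: "two_cocycle ?G ?\<sigma>" by (rule two_cocycle_sigma) (rule lam)
  have \<iota>_closed: "\<iota> r \<in> carrier A" if "r \<in> carrier ?G" for r
    using \<iota> that by (simp add: projective_unitary_rep_def unitary_def)
  note mem = projective_rep_mem_star_closed[OF A cocycle \<iota>]
  define S where "S = (\<lambda>i. \<iota> (gen_u i)) ` {1..n} \<union> (\<lambda>(j, k). \<iota> (gen_v j k)) ` index_pairs n"
  have S: "S \<subseteq> \<iota> ` carrier ?G"
    unfolding S_def using gen_u_closed[of _ n] gen_v_closed[of _ _ n] by auto
  have sub: "\<iota> ` carrier ?G \<subseteq> T" if "closed_star_subalgebra A T" "S \<subseteq> T" for T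
  proof (rule image_subsetI)
    fix r assume r: "r \<in> carrier ?G"
    show "\<iota> r \<in> T"
    proof (rule mem[OF _ _ _ _ _ r])
      show "1 \<le> n" using assms(1) by simp
      show "\<iota> (gen_u i) \<in> T" if "i \<in> {1..n}" for i using that \<open>S \<subseteq> T\<close> by (auto simp: S_def)
    qed (use \<open>closed_star_subalgebra A T\<close> in \<open>auto simp: closed_star_subalgebra_def\<close>)
  qed
  \<comment> \<open>Both sets of generators lie in the same closed star subalgebras, so one
    generates \<open>A\<close> when the other does.\<close>
  have "closed_star_subalgebra A T \<and> S \<subseteq> T
      \<longleftrightarrow> closed_star_subalgebra A T \<and> \<iota> ` carrier ?G \<subseteq> T" for T
    using sub[of T] order_trans[OF S, of T] by argo
  moreover have "S \<subseteq> carrier A" using S image_subsetI[OF \<iota>_closed] by (rule order_trans)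
  ultimately have "cstar_generated_by A S" using gen by (simp only: cstar_generated_by_def)
  moreover have "satisfies_relations n (lam_ext lam) A (\<lambda>i. \<iota> (gen_u i)) (\<lambda>j k. \<iota> (gen_v j k))"
    using A lam \<iota> by (rule projective_rep_satisfies_relations)
  moreover have "\<exists>!\<phi>. \<phi> \<in> star_hom A B \<and> (\<forall>i\<in>{1..n}. \<phi> (\<iota> (gen_u i)) = U i) \<and>
      (\<forall>(j, k)\<in>index_pairs n. \<phi> (\<iota> (gen_v j k)) = V j k)"
    if B: "unital_cstar_algebra B" and rel: "satisfies_relations n (lam_ext lam) B U V"
    for B :: "'b cstar" and U V
  proof -
    obtain W where W: "projective_unitary_rep ?G ?\<sigma> B W"
      "\<And>i. i \<in> {1..n} \<Longrightarrow> W (gen_u i) = U i"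
      "\<And>j k. (j, k) \<in> index_pairs n \<Longrightarrow> W (gen_v j k) = V j k"
      using exists_projective_rep[OF B lam rel] by blast
    from univ[OF B W(1)] obtain \<phi> where \<phi>: "\<phi> \<in> star_hom A B" "\<forall>r\<in>carrier ?G. \<phi> (\<iota> r) = W r"
      and \<phi>_unique: "\<And>\<psi>. \<psi> \<in> star_hom A B \<Longrightarrow> \<forall>r\<in>carrier ?G. \<psi> (\<iota> r) = W r \<Longrightarrow> \<psi> = \<phi>"
      by blast
    show ?thesis
    proof (rule ex1I[of _ \<phi>])
      show "\<phi> \<in> star_hom A B \<and> (\<forall>i\<in>{1..n}. \<phi> (\<iota> (gen_u i)) = U i) \<and>
          (\<forall>(j, k)\<in>index_pairs n. \<phi> (\<iota> (gen_v j k)) = V j k)"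
        using \<phi> W gen_u_closed gen_v_closed by auto
    next
      fix \<psi>
      assume \<psi>: "\<psi> \<in> star_hom A B \<and> (\<forall>i\<in>{1..n}. \<psi> (\<iota> (gen_u i)) = U i) \<and>
          (\<forall>(j, k)\<in>index_pairs n. \<psi> (\<iota> (gen_v j k)) = V j k)"
      \<comment> \<open>The set where \<psi> and \<phi> agree is closed under products, scalars and
        adjoints, so agreement on the \<open>gen_u i\<close> spreads to all of G(n), where
        uniqueness for \<open>W\<close> applies.\<close>
      have "\<iota> r \<in> {x \<in> carrier A. \<psi> x = \<phi> x}" if "r \<in> carrier ?G" for r
      proof (rule mem[OF _ _ _ _ _ that])
        show "1 \<le> n" using assms(1) by simp
        show "\<iota> (gen_u i) \<in> {x \<in> carrier A. \<psi> x = \<phi> x}" if i: "i \<in> {1..n}" for i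
          using \<psi> \<phi>(2) W(2)[OF i] i gen_u_closed[OF i] \<iota>_closed by simp
      qed (use \<phi>(1) \<psi> A.smult_mem in \<open>auto simp: star_hom_def ring_hom_def A.adj_closed\<close>)
      then have "\<forall>r\<in>carrier ?G. \<psi> (\<iota> r) = W r" using \<phi>(2) by auto
      then show "\<psi> = \<phi>" using \<psi> \<phi>_unique by blast
    qed
  qed
  ultimately show ?thesis
    using A unfolding is_universal_cstar_def S_def by blast
qed

end
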